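(* Let $G$ be a clique separable graph, and let $I_G\subset K[x_1,\dots,x_m]$ be the toric ideal of the stable set polytope of $G$. Then there exists a monomial order on $K[x_1,\dots,x_m]$ such that the initial ideal of $I_G$ with respect to it is squarefree and quadratic, i.e., generated by squarefree monomials of degree $2$.
   Context: All graphs are finite and simple. A clique in a graph is a set of pairwise adjacent vertices. A graph $G$ is obtained by gluing graphs $H_1$ and $H_2$ along their common clique if $H_1\cap H_2$ is a complete graph and $G=H_1\cup H_2$. A graph $G$ is called clique separable if $G$ is obtained by successive gluing along cliques starting with graphs of the following Type 1 or Type 2. Type 1: the join of a bipartite graph with more than 3 vertices with a complete graph. Type 2: a complete multipartite graph. (The join of two vertex-disjoint graphs is their disjoint union together with all edges between a vertex of one and a vertex of the other.) Let $G$ be a graph on the vertex set $[n]=\{1,\dots,n\}$. A subset $S\subset[n]$ is a stable set of $G$ if no two distinct elements of $S$ are adjacent; the empty set and singletons are stable. Let $S(G)=\{S_1,\dots,S_m\}$ be the set of all stable sets of $G$, and put $\rho(S)=\sum_{j\in S}\mathbf{e}_j\in\mathbb{R}^n$, where $\mathbf{e}_j$ is the $j$-th unit coordinate vector. The stable set polytope of $G$ is the convex hull of $\{\rho(S_1),\dots,\rho(S_m)\}$. Let $K$ be a field. The toric ideal $I_G$ of the stable set polytope of $G$ is the kernel of the $K$-algebra homomorphism $\pi_G:K[x_1,\dots,x_m]\to K[t_1,\dots,t_n,s]$ given by $\pi_G(x_i)=\mathbf{t}^{\rho(S_i)}s$, where $\mathbf{t}^{\mathbf{a}}=t_1^{a_1}\cdots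 t_n^{a_n}$. A monomial order is a total order $<$ on the monomials of $K[x_1,\dots,x_m]$ such that $1$ is the smallest monomial and $u<v$ implies $uw<vw$. The initial ideal of an ideal $I$ is the monomial ideal generated by the initial (largest) monomials of all nonzero elements of $I$. Convention: if $I_G=\{0\}$ (which happens exactly when $G$ is complete), the zero initial ideal counts as squarefree and quadratic. *)

theory Defs
  imports
    "HOL-Library.Poly_Mapping"
    "HOL-Library.Disjoint_Sets"
    "HOL-Algebra.Ideal"
    "HOL-Algebra.RingHom"
    "Graph_Theory.Kuratowski"
begin

section \<open>Clique separable graphs\<close>

text \<open>
  A finite simple graph is a \<open>pair_graph\<close>: each edge is represented by its two arcs
  \<open>(u,v)\<close> and \<open>(v,u)\<close>.
\<close>

definition complete_graph :: "'v pair_pre_digraph \<Rightarrow> bool" where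
  "complete_graph G \<longleftrightarrow> (\<exists>n. complete_digraph n (with_proj G))"

definition graph_union :: "'v pair_pre_digraph \<Rightarrow> 'v pair_pre_digraph \<Rightarrow> 'v pair_pre_digraph" where
  "graph_union G H = \<lparr>pverts = pverts G \<union> pverts H, parcs = parcs G \<union> parcs H\<rparr>"

definition graph_inter :: "'v pair_pre_digraph \<Rightarrow> 'v pair_pre_digraph \<Rightarrow> 'v pair_pre_digraph" where
  "graph_inter G H = \<lparr>pverts = pverts G \<inter> pverts H, parcs = parcs G \<inter> parcs H\<rparr>"

text \<open>Meaningful only for graphs with disjoint vertex sets.\<close>

definition graph_join :: "'v pair_pre_digraph \<Rightarrow> 'v pair_pre_digraph \<Rightarrow> 'v pair_pre_digraph" where
  "graph_join G H =
     \<lparr>pverts = pverts G \<union> pverts H,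
      parcs = parcs G \<union> parcs H \<union> pverts G \<times> pverts H \<union> pverts H \<times> pverts G\<rparr>"

definition bipartite_graph :: "'v pair_pre_digraph \<Rightarrow> bool" where
  "bipartite_graph G \<longleftrightarrow> pair_graph G \<and>
     (\<exists>U W. pverts G = U \<union> W \<and> U \<inter> W = {} \<and> parcs G \<subseteq> U \<times> W \<union> W \<times> U)"

definition complete_multipartite_graph :: "'v pair_pre_digraph \<Rightarrow> bool" where
  "complete_multipartite_graph G \<longleftrightarrow> pair_graph G \<and>
     (\<exists>P. partition_on (pverts G) P \<and>
        parcs G = {(u, v). u \<in> pverts G \<and> v \<in> pverts G \<and> \<not> (\<exists>p\<in>P. u \<in> p \<and> v \<in> p)})"

text \<open>
  The null graph counts as a complete graph.  Hence the complete factor in \<open>type1\<close> may be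
  empty, so that bipartite graphs with more than 3 vertices are covered, and gluing along the
  empty clique, i.e. disjoint union, is allowed.
\<close>

inductive clique_separable :: "'v pair_pre_digraph \<Rightarrow> bool" where
  type1: "\<lbrakk>bipartite_graph B; card (pverts B) > 3; complete_graph C; pverts B \<inter> pverts C = {}\<rbrakk>
    \<Longrightarrow> clique_separable (graph_join B C)"
| type2: "complete_multipartite_graph G \<Longrightarrow> clique_separable G"
| glue: "\<lbrakk>clique_separable H1; clique_separable H2; complete_graph (graph_inter H1 H2)\<rbrakk>
    \<Longrightarrow> clique_separable (graph_union H1 H2)"


section \<open>Polynomial rings\<close>

text \<open>
  Monomials in variables of type \<open>'i\<close> are their exponent vectors \<open>'i \<Rightarrow>\<^sub>0 nat\<close>, written
  additively: the monomial \<open>1\<close> is \<open>0\<close> and the product of \<open>u\<close> and \<open>v\<close> is \<open>u + v\<close>.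
  Polynomials are of type \<open>('i \<Rightarrow>\<^sub>0 nat) \<Rightarrow>\<^sub>0 'k\<close>, with the multiplication of the library
  being the convolution product.
\<close>

definition monomials :: "'i set \<Rightarrow> ('i \<Rightarrow>\<^sub>0 nat) set" where
  "monomials X = {u. Poly_Mapping.keys u \<subseteq> X}"

text \<open>The polynomial ring over \<open>'k\<close> in the set \<open>X\<close> of variables.\<close>

definition mpoly_ring :: "'i set \<Rightarrow> (('i \<Rightarrow>\<^sub>0 nat) \<Rightarrow>\<^sub>0 'k::comm_ring_1) ring" where
  "mpoly_ring X =
     \<lparr>carrier = {f. Poly_Mapping.keys f \<subseteq> monomials X},
      monoid.mult = (*), one = 1, zero = 0, add = (+)\<rparr>"

definition const_poly :: "'k \<Rightarrow> ('i \<Rightarrow>\<^sub>0 nat) \<Rightarrow>\<^sub>0 'k::comm_ring_1" where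
  "const_poly c = Poly_Mapping.single 0 c"

definition monom_poly :: "('i \<Rightarrow>\<^sub>0 nat) \<Rightarrow> ('i \<Rightarrow>\<^sub>0 nat) \<Rightarrow>\<^sub>0 'k::comm_ring_1" where
  "monom_poly u = Poly_Mapping.single u 1"

definition var_poly :: "'i \<Rightarrow> ('i \<Rightarrow>\<^sub>0 nat) \<Rightarrow>\<^sub>0 'k::comm_ring_1" where
  "var_poly i = monom_poly (Poly_Mapping.single i 1)"

text \<open>The \<open>'k\<close>-algebra homomorphism that sends each variable \<open>i\<close> to the polynomial \<open>g i\<close>.\<close>

definition subst_poly ::
  "('i \<Rightarrow> (('j \<Rightarrow>\<^sub>0 nat) \<Rightarrow>\<^sub>0 'k)) \<Rightarrow> (('i \<Rightarrow>\<^sub>0 nat) \<Rightarrow>\<^sub>0 'k) \<Rightarrow> (('j \<Rightarrow>\<^sub>0 nat) \<Rightarrow>\<^sub>0 'k::comm_ring_1)"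
where
  "subst_poly g f =
     (\<Sum>u\<in>Poly_Mapping.keys f.
        const_poly (Poly_Mapping.lookup f u) * (\<Prod>i\<in>Poly_Mapping.keys u. g i ^ Poly_Mapping.lookup u i))"

lemma mpoly_ring_simps [simp]:
  "carrier (mpoly_ring X) = {f. Poly_Mapping.keys f \<subseteq> monomials X}"
  "monoid.mult (mpoly_ring X) = (*)" "one (mpoly_ring X) = 1"
  "zero (mpoly_ring X) = 0" "add (mpoly_ring X) = (+)"
  by (simp_all add: mpoly_ring_def)

text \<open>
  The generated ideal \<open>Idl\<close> of the library is an intersection over all ideals above the
  generators, which is meaningful only over a ring.
\<close>

lemma cring_mpoly_ring: "cring (mpoly_ring X)"
proof -
  have add: "u + v \<in> monomials X" if "u \<in> monomials X" "v \<in> monomials X" for u v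
    using that Poly_Mapping.keys_add[of u v] by (auto simp: monomials_def)
  have zero: "0 \<in> monomials X"
    by (simp add: monomials_def)
  have clmult: "Poly_Mapping.keys (f * g) \<subseteq> monomials X"
    if "Poly_Mapping.keys f \<subseteq> monomials X" "Poly_Mapping.keys g \<subseteq> monomials X"
    for f g :: "(_ \<Rightarrow>\<^sub>0 nat) \<Rightarrow>\<^sub>0 'b"
    using that Poly_Mapping.keys_mult[of f g] add by fastforce
  have cladd: "Poly_Mapping.keys (f + g) \<subseteq> monomials X"
    if "Poly_Mapping.keys f \<subseteq> monomials X" "Poly_Mapping.keys g \<subseteq> monomials X"
    for f g :: "(_ \<Rightarrow>\<^sub>0 nat) \<Rightarrow>\<^sub>0 'b"
    using that Poly_Mapping.keys_add[of f g] by fastforce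
  have neg: "\<exists>g. Poly_Mapping.keys g \<subseteq> monomials X \<and> g + f = 0"
    if "Poly_Mapping.keys f \<subseteq> monomials X" for f :: "(_ \<Rightarrow>\<^sub>0 nat) \<Rightarrow>\<^sub>0 'b"
    using that by (intro exI[of _ "- f"]) (simp add: Poly_Mapping.keys_minus)
  show ?thesis
    by (intro cringI abelian_groupI comm_monoidI)
      (use cladd clmult neg zero in \<open>auto simp: algebra_simps\<close>)
qed


section \<open>Monomial orders and initial ideals\<close>

text \<open>Here \<open>(u, v) \<in> r\<close> stands for \<open>u \<le> v\<close>, and \<open>(u, v) \<in> r - Id\<close> for \<open>u < v\<close>.\<close>

definition monomial_order :: "'i set \<Rightarrow> ('i \<Rightarrow>\<^sub>0 nat) rel \<Rightarrow> bool" where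
  "monomial_order X r \<longleftrightarrow>
     linear_order_on (monomials X) r \<and>
     (\<forall>u\<in>monomials X. (0, u) \<in> r) \<and>
     (\<forall>u\<in>monomials X. \<forall>v\<in>monomials X. \<forall>w\<in>monomials X.
        (u, v) \<in> r - Id \<longrightarrow> (u + w, v + w) \<in> r - Id)"

definition initial_monomial :: "('i \<Rightarrow>\<^sub>0 nat) rel \<Rightarrow> (('i \<Rightarrow>\<^sub>0 nat) \<Rightarrow>\<^sub>0 'k::comm_ring_1) \<Rightarrow> 'i \<Rightarrow>\<^sub>0 nat"
where
  "initial_monomial r f =
     (THE u. u \<in> Poly_Mapping.keys f \<and> (\<forall>v\<in>Poly_Mapping.keys f. (v, u) \<in> r))"

definition monomial_ideal :: "'i set \<Rightarrow> ('i \<Rightarrow>\<^sub>0 nat) set \<Rightarrow> (('i \<Rightarrow>\<^sub>0 nat) \<Rightarrow>\<^sub>0 'k::comm_ring_1) set" where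
  "monomial_ideal X M = Idl\<^bsub>mpoly_ring X\<^esub> (monom_poly ` M)"

definition initial_ideal ::
  "'i set \<Rightarrow> ('i \<Rightarrow>\<^sub>0 nat) rel \<Rightarrow> (('i \<Rightarrow>\<^sub>0 nat) \<Rightarrow>\<^sub>0 'k::comm_ring_1) set \<Rightarrow> (('i \<Rightarrow>\<^sub>0 nat) \<Rightarrow>\<^sub>0 'k) set"
where
  "initial_ideal X r I = monomial_ideal X {initial_monomial r f | f. f \<in> I \<and> f \<noteq> 0}"

definition squarefree_monomial :: "('i \<Rightarrow>\<^sub>0 nat) \<Rightarrow> bool" where
  "squarefree_monomial u \<longleftrightarrow> (\<forall>i. Poly_Mapping.lookup u i \<le> 1)"

definition monomial_degree :: "('i \<Rightarrow>\<^sub>0 nat) \<Rightarrow> nat" where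
  "monomial_degree u = (\<Sum>i\<in>Poly_Mapping.keys u. Poly_Mapping.lookup u i)"

text \<open>The zero ideal is included: it is generated by the empty set of monomials.\<close>

definition squarefree_quadratic_ideal ::
  "'i set \<Rightarrow> (('i \<Rightarrow>\<^sub>0 nat) \<Rightarrow>\<^sub>0 'k::comm_ring_1) set \<Rightarrow> bool"
where
  "squarefree_quadratic_ideal X J \<longleftrightarrow>
     (\<exists>M \<subseteq> monomials X.
        (\<forall>u\<in>M. squarefree_monomial u \<and> monomial_degree u = 2) \<and> J = monomial_ideal X M)"


section \<open>The toric ideal of the stable set polytope\<close>

definition stable_sets :: "'v pair_pre_digraph \<Rightarrow> 'v set set" where
  "stable_sets G = {S. S \<subseteq> pverts G \<and> (\<forall>u\<in>S. \<forall>v\<in>S. u \<noteq> v \<longrightarrow> (u, v) \<notin> parcs G)}"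

text \<open>
  The vector \<open>\<rho>(S)\<close>, a vertex of the stable set polytope.  It has entries in the natural
  numbers and serves as an exponent vector.
\<close>

definition rho :: "'v set \<Rightarrow> 'v \<Rightarrow>\<^sub>0 nat" where
  "rho S = (\<Sum>j\<in>S. Poly_Mapping.single j 1)"

text \<open>
  The variables \<open>x\<^sub>1, \<dots>, x\<^sub>m\<close> are indexed by the stable sets themselves.  In the target ring
  the index \<open>Some j\<close> stands for \<open>t\<^sub>j\<close> and \<open>None\<close> for \<open>s\<close>.
\<close>

definition toric_map ::
  "'v pair_pre_digraph \<Rightarrow> (('v set \<Rightarrow>\<^sub>0 nat) \<Rightarrow>\<^sub>0 'k) \<Rightarrow> (('v option \<Rightarrow>\<^sub>0 nat) \<Rightarrow>\<^sub>0 'k::field)"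
where
  "toric_map G =
     subst_poly
       (\<lambda>S. (\<Prod>j\<in>pverts G. var_poly (Some j) ^ Poly_Mapping.lookup (rho S) j) * var_poly None)"

definition toric_ideal :: "'v pair_pre_digraph \<Rightarrow> (('v set \<Rightarrow>\<^sub>0 nat) \<Rightarrow>\<^sub>0 'k::field) set" where
  "toric_ideal G =
     a_kernel (mpoly_ring (stable_sets G)) (mpoly_ring (insert None (Some ` pverts G))) (toric_map G)"

end

theory Submission
  imports Defs
begin

text \<open>
  A monomial in the variables indexed by stable sets is a multiset of stable sets, and two
  monomials differ by an element of the toric ideal exactly when they have the same degree: the
  same number of sets, and every vertex lies in the same number of sets.  Fix a weight
  \<open>\<omega>\<close> on stable sets.  A pair \<open>S, T\<close> of stable sets is reducible if some pair of the same
  degree has smaller total weight, and a multiset is standard if no pair of its members is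
  reducible.  Call \<open>\<omega>\<close> a quadratic weight if every degree contains at most one standard
  multiset.

  A quadratic weight yields the Groebner basis (\<open>quadratic_weight_initial_ideal\<close>).  Take any
  monomial order that first compares weights.  Every reducible pair is the initial monomial of
  a quadratic binomial in the toric ideal.  Conversely, let \<open>u\<close> be the initial monomial of a
  nonzero \<open>f\<close> in the toric ideal.  Since the coefficients of \<open>f\<close> in each degree add up to zero,
  \<open>f\<close> has another monomial \<open>v\<close> of the same degree, and replacing reducible pairs turns \<open>v\<close> into
  a standard monomial \<open>v'\<close> that is not larger than \<open>v\<close>.  If \<open>u\<close> were standard, then \<open>u = v'\<close>
  by uniqueness, contradicting that \<open>u\<close> is larger than \<open>v\<close>.  So \<open>u\<close> is divisible by a reducible
  pair, and the two members of a reducible pair are distinct.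

  It remains to construct quadratic weights.
  For a bipartite graph with parts \<open>U\<close> and \<open>W\<close>, the symmetric differences of the stable sets
  with \<open>W\<close> form a lattice under intersection and union.  The weight \<open>N\<^sup>2 - |S \<triangle> W|\<^sup>2\<close>, for
  \<open>N\<close> the number of vertices, decreases when an incomparable pair is replaced by its meet and
  join, so that standard multisets are chains, and a chain is determined by its degree
  (\<open>chain_multiset_eqI\<close>).  A join with a complete graph adds only singletons, whose
  multiplicities can be read off the degree.
  In a complete multipartite graph the nonempty stable sets are the nonempty subsets of the
  parts, and the same argument with \<open>W = {}\<close> applies to each part; the number of empty sets is
  then determined by the total number of sets.
  Gluing along a clique is a toric fiber product (\<open>quadratic_weight_glue\<close>).  A stable set of the
  union is a pair of stable sets that agree on the clique, and they meet the clique in at most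
  one vertex.  The weight is a large multiple of the sum of the two given weights plus a term
  that favours pairs ordered in the same way.  The projections of a standard multiset are
  standard, hence determined by the degree, and among the sets with a given trace on the clique
  the pairs form a chain in a product of two linear orders, which is determined by its two
  projections.
\<close>

section \<open>Quadratic weights\<close>

text \<open>
  The number of members of \<open>m\<close>, counted with multiplicity, that contain \<open>v\<close>; this is the
  exponent of \<open>t\<^sub>v\<close> in the image of the monomial \<open>m\<close> under the toric map.
\<close>

definition vertex_degree :: "'v \<Rightarrow> 'v set multiset \<Rightarrow> nat" where
  "vertex_degree v m = size {#S \<in># m. v \<in> S#}"

text \<open>
  Equality of images under the toric map; the number of sets is the exponent of \<open>s\<close>.
\<close>

definition same_degree :: "'v set multiset \<Rightarrow> 'v set multiset \<Rightarrow> bool" where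
  "same_degree m m' \<longleftrightarrow> size m = size m' \<and> (\<forall>v. vertex_degree v m = vertex_degree v m')"

text \<open>
  The monomial \<open>S T\<close> can be replaced by a monomial of the same degree and of smaller weight.
\<close>

definition reducible :: "('v set \<Rightarrow> nat) \<Rightarrow> 'v set set \<Rightarrow> 'v set \<Rightarrow> 'v set \<Rightarrow> bool" where
  "reducible \<omega> F S T \<longleftrightarrow>
     (\<exists>S'\<in>F. \<exists>T'\<in>F. same_degree {#S, T#} {#S', T'#} \<and> \<omega> S' + \<omega> T' < \<omega> S + \<omega> T)"

text \<open>
  Here \<open>S\<close> and \<open>T\<close> may be the same member of \<open>m\<close>, even if its multiplicity is one; this is
  harmless because no set is reducible with itself (\<open>not_reducible_self\<close>).
\<close>

definition standard :: "('v set \<Rightarrow> nat) \<Rightarrow> 'v set set \<Rightarrow> 'v set multiset \<Rightarrow> bool" where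
  "standard \<omega> F m \<longleftrightarrow> set_mset m \<subseteq> F \<and> (\<forall>S\<in>#m. \<forall>T\<in>#m. \<not> reducible \<omega> F S T)"

text \<open>
  Standard monomials are determined by their degree: the reducible pairs generate the
  initial ideal with respect to an order refining \<open>\<omega>\<close>.
\<close>

definition quadratic_weight :: "'v set set \<Rightarrow> ('v set \<Rightarrow> nat) \<Rightarrow> bool" where
  "quadratic_weight F \<omega> \<longleftrightarrow>
     (\<forall>m m'. standard \<omega> F m \<and> standard \<omega> F m' \<and> same_degree m m' \<longrightarrow> m = m')"

lemma same_degree_refl [simp]: "same_degree m m"
  by (simp add: same_degree_def)

lemma same_degree_sym: "same_degree m m' \<Longrightarrow> same_degree m' m"
  by (simp add: same_degree_def)

lemma same_degree_trans: "same_degree l m \<Longrightarrow> same_degree m n \<Longrightarrow> same_degree l n"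
  by (simp add: same_degree_def)

lemma same_degree_union: "same_degree m m' \<Longrightarrow> same_degree l l' \<Longrightarrow> same_degree (m + l) (m' + l')"
  by (simp add: same_degree_def vertex_degree_def)

lemma same_degree_pair_iff:
  "same_degree {#S, T#} {#S', T'#} \<longleftrightarrow>
     (\<forall>v. (of_bool (v \<in> S) + of_bool (v \<in> T) :: nat) = of_bool (v \<in> S') + of_bool (v \<in> T'))"
proof -
  have "vertex_degree v {#S, T#} = of_bool (v \<in> S) + of_bool (v \<in> T)" for v and S T :: "'a set"
    by (simp add: vertex_degree_def)
  then show ?thesis
    by (simp add: same_degree_def)
qed

lemma not_reducible_self: "\<not> reducible \<omega> F S S"
proof
  assume "reducible \<omega> F S S"
  then obtain S' T' where deg: "same_degree {#S, S#} {#S', T'#}"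
    and less: "\<omega> S' + \<omega> T' < \<omega> S + \<omega> S"
    by (auto simp: reducible_def)
  have "v \<in> S' \<longleftrightarrow> v \<in> S" "v \<in> T' \<longleftrightarrow> v \<in> S" for v
    using deg[unfolded same_degree_pair_iff, THEN spec[of _ v]]
    by (auto simp: of_bool_def split: if_splits)
  then have "S' = S" "T' = S"
    by (auto intro!: set_eqI)
  with less show False
    by simp
qed

section \<open>Chains and lattices of sets\<close>

text \<open>
  A multiset of nonempty sets forming a chain is determined by the number of members that
  contain each element: the largest member is the set of elements that are contained in some
  member, and it can be removed.
\<close>

lemma chain_multiset_eqI:
  fixes g :: "'a \<Rightarrow> 'b set"
  assumes "inj_on g (set_mset A \<union> set_mset B)"
    and "\<And>x. x \<in># A \<Longrightarrow> g x \<noteq> {}" and "\<And>x. x \<in># B \<Longrightarrow> g x \<noteq> {}"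
    and "\<And>x y. x \<in># A \<Longrightarrow> y \<in># A \<Longrightarrow> g x \<subseteq> g y \<or> g y \<subseteq> g x"
    and "\<And>x y. x \<in># B \<Longrightarrow> y \<in># B \<Longrightarrow> g x \<subseteq> g y \<or> g y \<subseteq> g x"
    and "\<And>b. size {#x \<in># A. b \<in> g x#} = size {#x \<in># B. b \<in> g x#}"
  shows "A = B"
  using assms
proof (induction "size A" arbitrary: A B)
  case 0
  then have "{#x \<in># B. b \<in> g x#} = {#}" for b
    by simp
  then have "x \<notin># B" for x
    using 0(4)[of x] by auto
  with 0(1) show ?case
    by (auto simp: multiset_eq_iff not_in_iff)
next
  case (Suc n)
  have union: "(\<Union>x\<in>set_mset A. g x) = (\<Union>x\<in>set_mset B. g x)"
  proof -
    have "(\<exists>x\<in>#M. b \<in> g x) \<longleftrightarrow> size {#x \<in># M. b \<in> g x#} \<noteq> 0" for M b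
      by auto
    then have "(\<exists>x\<in>#A. b \<in> g x) \<longleftrightarrow> (\<exists>x\<in>#B. b \<in> g x)" for b
      by (simp only: Suc.prems(6))
    then show ?thesis
      by (auto simp: set_eq_iff)
  qed
  have top: "\<exists>x\<in>#M. g x = (\<Union>y\<in>set_mset M. g y)"
    if "M \<noteq> {#}" and chain: "\<And>x y. x \<in># M \<Longrightarrow> y \<in># M \<Longrightarrow> g x \<subseteq> g y \<or> g y \<subseteq> g x" for M
  proof -
    have "\<exists>z \<in> g ` set_mset M. \<forall>w \<in> g ` set_mset M. z \<le> w \<longrightarrow> z = w"
      using that(1) by (intro finite_has_maximal) auto
    then obtain x where "x \<in># M" and max: "\<And>y. y \<in># M \<Longrightarrow> g x \<subseteq> g y \<Longrightarrow> g x = g y"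
      by blast
    then have "g y \<subseteq> g x" if "y \<in># M" for y
      using chain[OF \<open>x \<in># M\<close> that] that by blast
    then show ?thesis
      using \<open>x \<in># M\<close> by blast
  qed
  have "A \<noteq> {#}"
    using Suc.hyps(2) by auto
  with top[of A] Suc.prems(4) obtain x where x: "x \<in># A" "g x = (\<Union>y\<in>set_mset A. g y)"
    by blast
  have "B \<noteq> {#}"
    using x union Suc.prems(2) by auto
  with top[of B] Suc.prems(5) obtain y where y: "y \<in># B" "g y = (\<Union>y\<in>set_mset B. g y)"
    by blast
  have "x = y"
    using x y union Suc.prems(1) by (metis UnCI inj_onD)
  have "A - {#x#} = B - {#x#}"
  proof (rule Suc.hyps(1))
    show "n = size (A - {#x#})"
      using Suc.hyps(2) x(1) by (simp add: size_Diff_singleton)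
    show "inj_on g (set_mset (A - {#x#}) \<union> set_mset (B - {#x#}))"
      using Suc.prems(1) by (rule inj_on_subset) (auto dest: in_diffD)
    show "size {#z \<in># A - {#x#}. b \<in> g z#} = size {#z \<in># B - {#x#}. b \<in> g z#}" for b
      using Suc.prems(6)[of b] x(1) y(1) \<open>x = y\<close>
      by (cases "b \<in> g x") (auto simp: size_Diff_singleton)
  qed (use Suc.prems(2-5) in \<open>(meson in_diffD)+\<close>)
  then show ?case
    using x(1) y(1) \<open>x = y\<close> by (metis insert_DiffM)
qed

text \<open>
  Passing to meet and join of the symmetric differences with \<open>W\<close> preserves the degree and the
  sum of the two cardinalities.  The sum of the squares of the cardinalities increases, because
  the cardinalities of meet and join are further apart.
\<close>

lemma reducible_if_incomparable:
  fixes V W S T :: "'v set"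
  defines "\<omega> \<equiv> \<lambda>S. (card V)\<^sup>2 - (card (sym_diff S W))\<^sup>2"
  assumes "finite V" "W \<subseteq> V" "S \<subseteq> V" "T \<subseteq> V"
    and meet: "sym_diff (sym_diff S W \<inter> sym_diff T W) W \<in> F" (is "?S' \<in> F")
    and join: "sym_diff (sym_diff S W \<union> sym_diff T W) W \<in> F" (is "?T' \<in> F")
    and incomparable: "\<not> sym_diff S W \<subseteq> sym_diff T W" "\<not> sym_diff T W \<subseteq> sym_diff S W"
  shows "reducible \<omega> F S T"
proof -
  define A B where "A = sym_diff S W" and "B = sym_diff T W"
  have sub: "A \<subseteq> V" "B \<subseteq> V"
    using assms by (auto simp: A_def B_def)
  then have fin: "finite A" "finite B"
    using \<open>finite V\<close> finite_subset by auto
  define i p q where "i = card (A \<inter> B)" and "p = card (A - B)" and "q = card (B - A)"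
  have "card A = i + p" "card B = i + q"
    using fin card_Int_Diff[of A B] card_Int_Diff[of B A] by (simp_all add: i_def p_def q_def Int_commute)
  have "card (A \<union> B) = i + p + q"
    using card_Un_Int[OF fin] \<open>card A = i + p\<close> \<open>card B = i + q\<close> i_def by simp
  have "p > 0" "q > 0"
    using incomparable fin by (auto simp: p_def q_def A_def[symmetric] B_def[symmetric] card_gt_0_iff)
  have "i + p + q \<le> card V"
    using card_mono[OF \<open>finite V\<close>, of "A \<union> B"] sub \<open>card (A \<union> B) = i + p + q\<close> by simp
  then have le: "(i + p + q)\<^sup>2 \<le> (card V)\<^sup>2" "i\<^sup>2 \<le> (card V)\<^sup>2"
    "(i + p)\<^sup>2 \<le> (card V)\<^sup>2" "(i + q)\<^sup>2 \<le> (card V)\<^sup>2"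
    by (simp_all add: power_mono)
  have "(i + p + q)\<^sup>2 + i\<^sup>2 = (i + p)\<^sup>2 + (i + q)\<^sup>2 + 2 * p * q"
    by (simp add: power2_eq_square algebra_simps)
  moreover have "p * q > 0"
    using \<open>p > 0\<close> \<open>q > 0\<close> by simp
  ultimately have "(i + p + q)\<^sup>2 + i\<^sup>2 > (i + p)\<^sup>2 + (i + q)\<^sup>2"
    by linarith
  moreover have "sym_diff ?S' W = A \<inter> B" "sym_diff ?T' W = A \<union> B"
    by (auto simp: A_def B_def)
  then have "\<omega> ?S' = (card V)\<^sup>2 - i\<^sup>2" "\<omega> ?T' = (card V)\<^sup>2 - (i + p + q)\<^sup>2"
    using \<open>card (A \<union> B) = i + p + q\<close> by (simp_all only: \<omega>_def i_def)
  moreover have "\<omega> S = (card V)\<^sup>2 - (i + p)\<^sup>2" "\<omega> T = (card V)\<^sup>2 - (i + q)\<^sup>2"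
    using \<open>card A = i + p\<close> \<open>card B = i + q\<close> by (simp_all only: \<omega>_def A_def B_def)
  ultimately have "\<omega> ?S' + \<omega> ?T' < \<omega> S + \<omega> T"
    using le by linarith
  moreover have "same_degree {#S, T#} {#?S', ?T'#}"
    by (auto simp: same_degree_pair_iff of_bool_def)
  ultimately show ?thesis
    using meet join unfolding reducible_def by blast
qed

text \<open>
  The typical case of \<open>L\<close> is the family of stable sets of a bipartite graph on \<open>V\<close> with \<open>W\<close> as one
  of its parts; the join with the complete graph on \<open>C\<close> adds the singletons.  The weight of these
  singletons does not matter.
\<close>

lemma quadratic_weight_lattice_join:
  fixes V W C :: "'v set"
  defines "\<omega> \<equiv> \<lambda>S. (card V)\<^sup>2 - (card (sym_diff S W))\<^sup>2"
  assumes "finite V" "W \<subseteq> V" "V \<inter> C = {}" "L \<subseteq> Pow V"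
    and F: "F = L \<union> (\<lambda>c. {c}) ` C"
    and meet: "\<And>S T. S \<in> L \<Longrightarrow> T \<in> L \<Longrightarrow> sym_diff (sym_diff S W \<inter> sym_diff T W) W \<in> L"
    and join: "\<And>S T. S \<in> L \<Longrightarrow> T \<in> L \<Longrightarrow> sym_diff (sym_diff S W \<union> sym_diff T W) W \<in> L"
  shows "quadratic_weight F \<omega>"
  unfolding quadratic_weight_def
proof (intro allI impI, elim conjE)
  fix m m' assume std: "standard \<omega> F m" "standard \<omega> F m'" and deg: "same_degree m m'"
  have split: "m = {#S \<in># m. S \<subseteq> V#} + {#S \<in># m. \<not> S \<subseteq> V#}" for m :: "'v set multiset"
    by (rule multiset_partition)
  have L_iff: "S \<in> L \<longleftrightarrow> S \<subseteq> V" if "S \<in> F" for S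
    using that \<open>L \<subseteq> Pow V\<close> \<open>V \<inter> C = {}\<close> by (auto simp: F)
  \<comment> \<open>The singleton of \<open>c\<close> is the only member of \<open>F\<close> that contains \<open>c\<close>.\<close>
  have single: "count {#S \<in># n. \<not> S \<subseteq> V#} S =
      (if S \<in> (\<lambda>c. {c}) ` C then vertex_degree (the_elem S) n else 0)"
    if "standard \<omega> F n" for n S
  proof -
    have nF: "T \<in> F" if "T \<in># n" for T
      using that \<open>standard \<omega> F n\<close> by (auto simp: standard_def)
    show ?thesis
    proof (cases "S \<in> (\<lambda>c. {c}) ` C")
      case True
      then obtain c where c: "c \<in> C" "S = {c}"
        by auto
      have "{#T \<in># n. c \<in> T#} = {#T \<in># n. T = S#}"
        using nF c \<open>L \<subseteq> Pow V\<close> \<open>V \<inter> C = {}\<close> by (intro filter_mset_cong) (auto simp: F)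
      then have "vertex_degree c n = count n S"
        by (simp add: vertex_degree_def filter_eq_replicate_mset)
      moreover have "\<not> S \<subseteq> V"
        using c \<open>V \<inter> C = {}\<close> by auto
      ultimately show ?thesis
        using c by auto
    next
      case False
      then have "S \<notin># n \<or> S \<subseteq> V"
        using nF[of S] \<open>L \<subseteq> Pow V\<close> by (auto simp: F)
      with False show ?thesis
        by (auto simp: not_in_iff)
    qed
  qed
  have rest: "{#S \<in># m. \<not> S \<subseteq> V#} = {#S \<in># m'. \<not> S \<subseteq> V#}"
    using deg by (intro multiset_eqI) (simp only: single[OF std(1)] single[OF std(2)] same_degree_def)
  have size: "size {#S \<in># m. S \<subseteq> V#} = size {#S \<in># m'. S \<subseteq> V#}"
  proof -
    have "size m = size m'"
      using deg by (simp add: same_degree_def)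
    then show ?thesis
      using split[of m] split[of m'] rest by (metis add_right_cancel size_union)
  qed
  have deg_V: "size {#S \<in># {#S \<in># n. S \<subseteq> V#}. v \<in> S#} = (if v \<in> V then vertex_degree v n else 0)"
    if "standard \<omega> F n" for n v
  proof -
    have "{#S \<in># {#S \<in># n. S \<subseteq> V#}. v \<in> S#} = (if v \<in> V then {#S \<in># n. v \<in> S#} else {#})"
    proof (cases "v \<in> V")
      case True
      have "S \<subseteq> V" if "S \<in># n" "v \<in> S" for S
        using that True \<open>standard \<omega> F n\<close> \<open>L \<subseteq> Pow V\<close> \<open>V \<inter> C = {}\<close>
        by (auto simp: standard_def F)
      then have "{#S \<in># n. S \<subseteq> V \<and> v \<in> S#} = {#S \<in># n. v \<in> S#}"
        by (intro filter_mset_cong) auto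
      with True show ?thesis
        by (simp add: filter_filter_mset conj_commute)
    qed auto
    then show ?thesis
      by (simp add: vertex_degree_def)
  qed
  \<comment> \<open>The additional element \<open>None\<close> makes all sets nonempty; it occurs once in each of them.\<close>
  define g where "g S = insert None (Some ` sym_diff S W)" for S
  have chain: "g S \<subseteq> g T \<or> g T \<subseteq> g S"
    if n: "standard \<omega> F n" and S: "S \<in># {#S \<in># n. S \<subseteq> V#}" and T: "T \<in># {#S \<in># n. S \<subseteq> V#}" for n S T
  proof (rule ccontr)
    assume "\<not> ?thesis"
    then have inc: "\<not> sym_diff S W \<subseteq> sym_diff T W" "\<not> sym_diff T W \<subseteq> sym_diff S W"
      by (auto simp: g_def)
    have "S \<in># n" "T \<in># n"
      using S T by auto
    then have ST: "S \<in> L" "T \<in> L"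
      using S T n L_iff by (auto simp: standard_def)
    have "reducible \<omega> F S T"
      unfolding \<omega>_def
      using ST \<open>L \<subseteq> Pow V\<close> meet[OF ST] join[OF ST]
      by (intro reducible_if_incomparable inc) (use \<open>finite V\<close> \<open>W \<subseteq> V\<close> in \<open>auto simp: F\<close>)
    then show False
      using n \<open>S \<in># n\<close> \<open>T \<in># n\<close> by (auto simp: standard_def)
  qed
  have "{#S \<in># m. S \<subseteq> V#} = {#S \<in># m'. S \<subseteq> V#}"
  proof (rule chain_multiset_eqI[of g])
    show "inj_on g (set_mset {#S \<in># m. S \<subseteq> V#} \<union> set_mset {#S \<in># m'. S \<subseteq> V#})"
    proof (rule inj_onI)
      fix S T assume "g S = g T"
      then have "sym_diff S W = sym_diff T W"
        by (auto simp: g_def set_eq_iff)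
      then show "S = T"
        by blast
    qed
    fix b
    let ?n = "{#S \<in># m. S \<subseteq> V#}" and ?n' = "{#S \<in># m'. S \<subseteq> V#}"
    show "size {#S \<in># ?n. b \<in> g S#} = size {#S \<in># ?n'. b \<in> g S#}"
    proof (cases b)
      case None
      then show ?thesis
        using size by (simp add: g_def)
    next
      case (Some v)
      have inv: "size {#S \<in># ?n. v \<in> S#} = size {#S \<in># ?n'. v \<in> S#}"
        using deg by (simp only: deg_V[OF std(1)] deg_V[OF std(2)] same_degree_def)
      have co: "size {#S \<in># n. v \<notin> S#} = size n - size {#S \<in># n. v \<in> S#}" for n :: "'v set multiset"
        using arg_cong[OF multiset_partition[of n "\<lambda>S. v \<in> S"], of size]
        unfolding size_union by linarith
      have "b \<in> g S \<longleftrightarrow> (if v \<in> W then v \<notin> S else v \<in> S)" for S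
        using Some by (auto simp: g_def)
      then show ?thesis
        using inv size co[of ?n] co[of ?n'] by (cases "v \<in> W") simp_all
    qed
  qed (use chain[OF std(1)] chain[OF std(2)] in \<open>auto simp: g_def\<close>)
  with rest show "m = m'"
    using split[of m] split[of m'] by metis
qed

lemma quadratic_weight_multipartite:
  fixes V :: "'v set"
  assumes "finite V" and P: "partition_on V P"
  shows "quadratic_weight (insert {} (\<Union>p\<in>P. Pow p)) (\<lambda>S. (card V)\<^sup>2 - (card S)\<^sup>2)"
    (is "quadratic_weight ?F ?\<omega>")
  unfolding quadratic_weight_def
proof (intro allI impI, elim conjE)
  fix m m' assume std: "standard ?\<omega> ?F m" "standard ?\<omega> ?F m'" and deg: "same_degree m m'"
  have disj: "p = q" if "p \<in> P" "q \<in> P" "v \<in> p" "v \<in> q" for p q v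
    using partition_onD2[OF P] that by (auto simp: disjoint_def)
  have part: "{#S \<in># m. S \<subseteq> p \<and> S \<noteq> {}#} = {#S \<in># m'. S \<subseteq> p \<and> S \<noteq> {}#}" if p: "p \<in> P" for p
  proof (rule chain_multiset_eqI[of "\<lambda>S. S"])
    have "p \<subseteq> V"
      using P p by (auto simp: partition_on_def)
    have chain: "S \<subseteq> T \<or> T \<subseteq> S"
      if n: "standard ?\<omega> ?F n" and ST: "S \<in># n" "S \<subseteq> p" "T \<in># n" "T \<subseteq> p" for n S T
    proof (rule ccontr)
      assume inc: "\<not> ?thesis"
      have "S \<inter> T \<in> ?F" "S \<union> T \<in> ?F" "S \<subseteq> V" "T \<subseteq> V"
        using ST p \<open>p \<subseteq> V\<close> by blast+
      then have "reducible ?\<omega> ?F S T"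
        using reducible_if_incomparable[of V "{}" S T ?F] inc \<open>finite V\<close> by simp
      then show False
        using n ST by (auto simp: standard_def)
    qed
    show "S \<subseteq> T \<or> T \<subseteq> S"
      if "S \<in># {#S \<in># m. S \<subseteq> p \<and> S \<noteq> {}#}" "T \<in># {#S \<in># m. S \<subseteq> p \<and> S \<noteq> {}#}" for S T
      using chain[OF std(1)] that by auto
    show "S \<subseteq> T \<or> T \<subseteq> S"
      if "S \<in># {#S \<in># m'. S \<subseteq> p \<and> S \<noteq> {}#}" "T \<in># {#S \<in># m'. S \<subseteq> p \<and> S \<noteq> {}#}" for S T
      using chain[OF std(2)] that by auto
    have deg_p: "size {#S \<in># {#S \<in># n. S \<subseteq> p \<and> S \<noteq> {}#}. v \<in> S#} = (if v \<in> p then vertex_degree v n else 0)"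
      if "standard ?\<omega> ?F n" for n v
    proof (cases "v \<in> p")
      case True
      have "S \<subseteq> p" if "S \<in># n" "v \<in> S" for S
        using that True \<open>standard ?\<omega> ?F n\<close> disj[OF p] by (fastforce simp: standard_def)
      then have "{#S \<in># n. (S \<subseteq> p \<and> S \<noteq> {}) \<and> v \<in> S#} = {#S \<in># n. v \<in> S#}"
        by (intro filter_mset_cong) auto
      with True show ?thesis
        by (simp add: filter_filter_mset vertex_degree_def conj_ac)
    qed auto
    show "size {#S \<in># {#S \<in># m. S \<subseteq> p \<and> S \<noteq> {}#}. v \<in> S#}
        = size {#S \<in># {#S \<in># m'. S \<subseteq> p \<and> S \<noteq> {}#}. v \<in> S#}" for v
      using deg by (simp only: deg_p[OF std(1)] deg_p[OF std(2)] same_degree_def)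
  qed auto
  have nonempty: "count m S = count m' S" if "S \<noteq> {}" for S
  proof (cases "S \<in> ?F")
    case True
    with that obtain p where "p \<in> P" "S \<subseteq> p"
      by auto
    then show ?thesis
      using arg_cong[OF part[of p], of "\<lambda>n. count n S"] that by simp
  next
    case False
    then show ?thesis
      using std by (metis count_eq_zero_iff standard_def subsetD)
  qed
  have size: "size n = count n {} + size {#S \<in># n. S \<noteq> {}#}" for n :: "'v set multiset"
    using arg_cong[OF multiset_partition[of n "\<lambda>S. S = {}"], of size]
    by (simp add: filter_eq_replicate_mset)
  have "{#S \<in># m. S \<noteq> {}#} = {#S \<in># m'. S \<noteq> {}#}"
    using nonempty by (intro multiset_eqI) simp
  then have "count m {} = count m' {}"
    using size[of m] size[of m'] deg by (simp add: same_degree_def)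
  with nonempty show "m = m'"
    by (intro multiset_eqI) metis
qed

section \<open>Gluing along a clique\<close>

lemma subsingleton_pair_eq:
  assumes "\<And>X u v. X \<in> {A, B, A', B'} \<Longrightarrow> u \<in> X \<Longrightarrow> v \<in> X \<Longrightarrow> u = v"
    and "\<And>v. (of_bool (v \<in> A) + of_bool (v \<in> B) :: nat) = of_bool (v \<in> A') + of_bool (v \<in> B')"
  shows "(A' = A \<and> B' = B) \<or> (A' = B \<and> B' = A)"
proof -
  have sub: "X = {} \<or> (\<exists>x. X = {x})" if "X \<in> {A, B, A', B'}" for X
    using assms(1)[OF that] by blast
  have "v \<in> A \<union> B \<longleftrightarrow> v \<in> A' \<union> B'" "v \<in> A \<inter> B \<longleftrightarrow> v \<in> A' \<inter> B'" for v
    using assms(2)[of v] by (auto simp: of_bool_def split: if_splits)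
  then have "A \<union> B = A' \<union> B'" "A \<inter> B = A' \<inter> B'"
    by (auto intro!: set_eqI simp del: Un_iff Int_iff)
  moreover have "A = {} \<or> (\<exists>a. A = {a})" "B = {} \<or> (\<exists>b. B = {b})"
    "A' = {} \<or> (\<exists>a. A' = {a})" "B' = {} \<or> (\<exists>b. B' = {b})"
    by (rule sub; simp)+
  ultimately show ?thesis
    by - (elim disjE exE; auto simp: doubleton_eq_iff)
qed

text \<open>
  The members of \<open>F\<close> meet the clique \<open>K\<close> in at most one vertex.  Hence the traces of a pair on \<open>K\<close>
  are determined by its degree up to order, and a replacement can be arranged to preserve them.
\<close>

lemma reducible_aligned:
  assumes "reducible \<omega> F S T" "S \<in> F" "T \<in> F"
    and sub: "\<And>A u v. A \<in> F \<Longrightarrow> u \<in> A \<inter> K \<Longrightarrow> v \<in> A \<inter> K \<Longrightarrow> u = v"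
  obtains S' T' where "S' \<in> F" "T' \<in> F" "same_degree {#S, T#} {#S', T'#}"
    "\<omega> S' + \<omega> T' < \<omega> S + \<omega> T" "S' \<inter> K = S \<inter> K" "T' \<inter> K = T \<inter> K"
proof -
  obtain S' T' where *: "S' \<in> F" "T' \<in> F" "same_degree {#S, T#} {#S', T'#}"
    "\<omega> S' + \<omega> T' < \<omega> S + \<omega> T"
    using assms(1) by (auto simp: reducible_def)
  have "(of_bool (v \<in> S \<inter> K) + of_bool (v \<in> T \<inter> K) :: nat)
      = of_bool (v \<in> S' \<inter> K) + of_bool (v \<in> T' \<inter> K)" for v
    using *(3)[unfolded same_degree_pair_iff, THEN spec[of _ v]] by (cases "v \<in> K") simp_all
  then have "(S' \<inter> K = S \<inter> K \<and> T' \<inter> K = T \<inter> K) \<or> (S' \<inter> K = T \<inter> K \<and> T' \<inter> K = S \<inter> K)"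
    by (intro subsingleton_pair_eq) (use *(1,2) assms(2,3) sub in auto)
  then show ?thesis
    using that[of S' T'] that[of T' S'] * by (metis add.commute add_mset_commute)
qed

text \<open>
  With \<open>F1\<close> and \<open>F2\<close> the stable sets of two graphs on \<open>V1\<close> and \<open>V2\<close> that intersect in a clique,
  the family below consists of the stable sets of their union.
\<close>

lemma quadratic_weight_glue:
  fixes V1 V2 :: "'v set"
  assumes "finite F1" "F1 \<subseteq> Pow V1" "quadratic_weight F1 \<omega>1"
    and "finite F2" "F2 \<subseteq> Pow V2" "quadratic_weight F2 \<omega>2"
    and sub1: "\<And>S u v. S \<in> F1 \<Longrightarrow> u \<in> S \<inter> (V1 \<inter> V2) \<Longrightarrow> v \<in> S \<inter> (V1 \<inter> V2) \<Longrightarrow> u = v"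
    and sub2: "\<And>S u v. S \<in> F2 \<Longrightarrow> u \<in> S \<inter> (V1 \<inter> V2) \<Longrightarrow> v \<in> S \<inter> (V1 \<inter> V2) \<Longrightarrow> u = v"
  shows "\<exists>\<omega>. quadratic_weight {S. S \<subseteq> V1 \<union> V2 \<and> S \<inter> V1 \<in> F1 \<and> S \<inter> V2 \<in> F2} \<omega>"
proof -
  define F where "F = {S. S \<subseteq> V1 \<union> V2 \<and> S \<inter> V1 \<in> F1 \<and> S \<inter> V2 \<in> F2}"
  define K where "K = V1 \<inter> V2"
  obtain r1 R1 where r1: "inj_on r1 F1" "r1 ` F1 = {i::nat. i < R1}"
    using finite_imp_inj_to_nat_seg[OF assms(1)] by metis
  obtain r2 R2 where r2: "inj_on r2 F2" "r2 ` F2 = {i::nat. i < R2}"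
    using finite_imp_inj_to_nat_seg[OF assms(4)] by metis
  \<comment> \<open>The ranks \<open>r1\<close> and \<open>r2\<close> order the two families arbitrarily.  Exchanging the second
    components of two pairs that are ordered in opposite ways decreases the sum of \<open>\<phi>\<close>.  Two values
    of \<open>\<phi>\<close> add up to at most \<open>2 * R\<close>, so that the factor \<open>2 * R + 1\<close> lets \<open>\<omega>1\<close> and \<open>\<omega>2\<close> dominate.\<close>
  define R where "R = R1 * R2"
  define \<phi> where "\<phi> S = R - r1 (S \<inter> V1) * r2 (S \<inter> V2)" for S
  define \<omega> where "\<omega> S = (2 * R + 1) * (\<omega>1 (S \<inter> V1) + \<omega>2 (S \<inter> V2)) + \<phi> S" for S
  have \<phi>_le: "\<phi> S \<le> R" for S
    by (simp add: \<phi>_def)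
  have FD: "S \<inter> V1 \<in> F1" "S \<inter> V2 \<in> F2" "(S \<inter> V1) \<union> (S \<inter> V2) = S" if "S \<in> F" for S
    using that by (auto simp: F_def)
  have K_int: "S \<inter> V1 \<inter> K = S \<inter> K" "S \<inter> V2 \<inter> K = S \<inter> K" for S
    by (auto simp: K_def)
  have paste: "(A \<union> B) \<inter> V1 = A" "(A \<union> B) \<inter> V2 = B" "A \<union> B \<in> F"
    if "A \<in> F1" "B \<in> F2" "A \<inter> K = B \<inter> K" for A B
  proof -
    have "A \<subseteq> V1" "B \<subseteq> V2"
      using that assms(2,5) by auto
    then show 1: "(A \<union> B) \<inter> V1 = A" "(A \<union> B) \<inter> V2 = B"
      using that(3) by (auto simp: K_def)
    then show "A \<union> B \<in> F"
      using that \<open>A \<subseteq> V1\<close> \<open>B \<subseteq> V2\<close> by (auto simp: F_def)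
  qed
  have deg_glue: "same_degree {#S, T#} {#S', T'#}"
    if "S \<in> F" "T \<in> F" "S' \<in> F" "T' \<in> F"
      and "same_degree {#S \<inter> V1, T \<inter> V1#} {#S' \<inter> V1, T' \<inter> V1#}"
      and "same_degree {#S \<inter> V2, T \<inter> V2#} {#S' \<inter> V2, T' \<inter> V2#}" for S T S' T'
    unfolding same_degree_pair_iff
  proof
    fix v
    consider "v \<in> V1" | "v \<in> V2" | "v \<notin> V1 \<union> V2"
      by blast
    then show "(of_bool (v \<in> S) + of_bool (v \<in> T) :: nat) = of_bool (v \<in> S') + of_bool (v \<in> T')"
    proof cases
      case 1
      then show ?thesis
        using that(5)[unfolded same_degree_pair_iff, THEN spec[of _ v]] by simp
    next
      case 2
      then show ?thesis
        using that(6)[unfolded same_degree_pair_iff, THEN spec[of _ v]] by simp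
    next
      case 3
      then have "v \<notin> S" "v \<notin> T" "v \<notin> S'" "v \<notin> T'"
        using that(1-4) by (auto simp: F_def)
      then show ?thesis
        by simp
    qed
  qed
  have weight_less: "\<omega> S' + \<omega> T' < \<omega> S + \<omega> T"
    if "\<omega>1 (S' \<inter> V1) + \<omega>2 (S' \<inter> V2) + (\<omega>1 (T' \<inter> V1) + \<omega>2 (T' \<inter> V2))
      < \<omega>1 (S \<inter> V1) + \<omega>2 (S \<inter> V2) + (\<omega>1 (T \<inter> V1) + \<omega>2 (T \<inter> V2))" (is "?a < ?b") for S T S' T'
  proof -
    have "\<omega> S' + \<omega> T' = (2 * R + 1) * ?a + (\<phi> S' + \<phi> T')"
      unfolding \<omega>_def by (simp add: algebra_simps)
    also have "\<dots> \<le> (2 * R + 1) * ?a + 2 * R"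
      using \<phi>_le[of S'] \<phi>_le[of T'] by simp
    also have "\<dots> < (2 * R + 1) * (?a + 1)"
      by simp
    also have "\<dots> \<le> (2 * R + 1) * ?b"
      using that by (intro mult_le_mono) auto
    also have "\<dots> \<le> \<omega> S + \<omega> T"
      unfolding \<omega>_def by (simp add: algebra_simps)
    finally show ?thesis .
  qed
  \<comment> \<open>A replacement on one side extends to the union with the components on the other side kept.\<close>
  have red1: "reducible \<omega> F S T"
    if ST: "S \<in> F" "T \<in> F" and red: "reducible \<omega>1 F1 (S \<inter> V1) (T \<inter> V1)" for S T
  proof -
    obtain A B where AB: "A \<in> F1" "B \<in> F1" "same_degree {#S \<inter> V1, T \<inter> V1#} {#A, B#}"
      "\<omega>1 A + \<omega>1 B < \<omega>1 (S \<inter> V1) + \<omega>1 (T \<inter> V1)" "A \<inter> K = S \<inter> V1 \<inter> K" "B \<inter> K = T \<inter> V1 \<inter> K"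
      using reducible_aligned[OF red FD(1)[OF ST(1)] FD(1)[OF ST(2)], of K] sub1
      unfolding K_def by metis
    have "A \<inter> K = S \<inter> V2 \<inter> K" "B \<inter> K = T \<inter> V2 \<inter> K"
      using AB(5,6) by (simp_all only: K_int)
    note p = paste[OF AB(1) FD(2)[OF ST(1)] this(1)] paste[OF AB(2) FD(2)[OF ST(2)] this(2)]
    have "same_degree {#S, T#} {#A \<union> (S \<inter> V2), B \<union> (T \<inter> V2)#}"
      using ST p(3,6) AB(3) by - (rule deg_glue; simp only: p same_degree_refl)
    moreover have "\<omega> (A \<union> (S \<inter> V2)) + \<omega> (B \<union> (T \<inter> V2)) < \<omega> S + \<omega> T"
      using AB(4) by (intro weight_less) (simp add: p)
    ultimately show ?thesis
      using p(3,6) unfolding reducible_def by blast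
  qed
  have red2: "reducible \<omega> F S T"
    if ST: "S \<in> F" "T \<in> F" and red: "reducible \<omega>2 F2 (S \<inter> V2) (T \<inter> V2)" for S T
  proof -
    obtain A B where AB: "A \<in> F2" "B \<in> F2" "same_degree {#S \<inter> V2, T \<inter> V2#} {#A, B#}"
      "\<omega>2 A + \<omega>2 B < \<omega>2 (S \<inter> V2) + \<omega>2 (T \<inter> V2)" "A \<inter> K = S \<inter> V2 \<inter> K" "B \<inter> K = T \<inter> V2 \<inter> K"
      using reducible_aligned[OF red FD(2)[OF ST(1)] FD(2)[OF ST(2)], of K] sub2
      unfolding K_def by metis
    have "S \<inter> V1 \<inter> K = A \<inter> K" "T \<inter> V1 \<inter> K = B \<inter> K"
      using AB(5,6) by (simp_all only: K_int)
    note p = paste[OF FD(1)[OF ST(1)] AB(1) this(1)] paste[OF FD(1)[OF ST(2)] AB(2) this(2)]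
    have "same_degree {#S, T#} {#(S \<inter> V1) \<union> A, (T \<inter> V1) \<union> B#}"
      using ST p(3,6) AB(3) by - (rule deg_glue; simp only: p same_degree_refl)
    moreover have "\<omega> ((S \<inter> V1) \<union> A) + \<omega> ((T \<inter> V1) \<union> B) < \<omega> S + \<omega> T"
      using AB(4) by (intro weight_less) (simp add: p)
    ultimately show ?thesis
      using p(3,6) unfolding reducible_def by blast
  qed
  have swap: "reducible \<omega> F S T"
    if ST: "S \<in> F" "T \<in> F" "S \<inter> K = T \<inter> K"
      and less: "r1 (S \<inter> V1) < r1 (T \<inter> V1)" "r2 (T \<inter> V2) < r2 (S \<inter> V2)" for S T
  proof -
    let ?A = "(S \<inter> V1) \<union> (T \<inter> V2)" and ?B = "(T \<inter> V1) \<union> (S \<inter> V2)"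
    have "S \<inter> V1 \<inter> K = T \<inter> V2 \<inter> K" "T \<inter> V1 \<inter> K = S \<inter> V2 \<inter> K"
      using ST(3) by (simp_all only: K_int)
    note p = paste[OF FD(1)[OF ST(1)] FD(2)[OF ST(2)] this(1)]
      paste[OF FD(1)[OF ST(2)] FD(2)[OF ST(1)] this(2)]
    have "same_degree {#S, T#} {#?A, ?B#}"
      using ST p(3,6) by - (rule deg_glue; simp add: p add_mset_commute)
    moreover have "\<omega> ?A + \<omega> ?B < \<omega> S + \<omega> T"
    proof -
      obtain a b c d where abcd: "a = r1 (S \<inter> V1)" "b = r1 (T \<inter> V1)" "c = r2 (T \<inter> V2)" "d = r2 (S \<inter> V2)"
        by blast
      have "b < R1" "d < R2"
        using abcd r1(2) r2(2) FD ST by blast+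
      then have le: "a * c \<le> R" "b * d \<le> R" "a * d \<le> R" "b * c \<le> R"
        using less abcd by (auto simp: R_def intro: mult_le_mono)
      obtain x y where xy: "b = a + x" "d = c + y" "x > 0" "y > 0"
        using less abcd by (metis less_imp_add_positive)
      then have "a * d + b * c < a * c + b * d"
        by (simp add: algebra_simps)
      then have "\<phi> ?A + \<phi> ?B < \<phi> S + \<phi> T"
        unfolding \<phi>_def p abcd(1-4)[symmetric] using le by linarith
      then show ?thesis
        by (simp add: \<omega>_def p algebra_simps)
    qed
    ultimately show ?thesis
      using p(3,6) unfolding reducible_def by blast
  qed
  have proj: "standard \<omega>1 F1 (image_mset (\<lambda>S. S \<inter> V1) m)" "standard \<omega>2 F2 (image_mset (\<lambda>S. S \<inter> V2) m)"
    if "standard \<omega> F m" for m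
    using that FD(1,2) red1 red2 unfolding standard_def by (simp_all add: subset_iff image_subset_iff) blast+
  have deg_proj: "same_degree (image_mset (\<lambda>S. S \<inter> U) m) (image_mset (\<lambda>S. S \<inter> U) m')"
    if "same_degree m m'" for U and m m' :: "'v set multiset"
  proof -
    have "vertex_degree v (image_mset (\<lambda>S. S \<inter> U) m) = (if v \<in> U then vertex_degree v m else 0)" for v m
      by (simp add: vertex_degree_def filter_mset_image_mset)
    with that show ?thesis
      by (simp add: same_degree_def)
  qed
  have "m = m'" if std: "standard \<omega> F m" "standard \<omega> F m'" and deg: "same_degree m m'" for m m'
  proof -
    have img1: "image_mset (\<lambda>S. S \<inter> V1) m = image_mset (\<lambda>S. S \<inter> V1) m'"
      using assms(3) proj(1) std deg_proj[OF deg] by (auto simp: quadratic_weight_def)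
    have img2: "image_mset (\<lambda>S. S \<inter> V2) m = image_mset (\<lambda>S. S \<inter> V2) m'"
      using assms(6) proj(2) std deg_proj[OF deg] by (auto simp: quadratic_weight_def)
    \<comment> \<open>Inclusion of the sets \<open>g S\<close> is the product order of the two ranks.\<close>
    define g :: "'v set \<Rightarrow> (nat + nat) set"
      where "g S = Inl ` {..r1 (S \<inter> V1)} \<union> Inr ` {..r2 (S \<inter> V2)}" for S
    have g_mem: "Inl i \<in> g S \<longleftrightarrow> i \<le> r1 (S \<inter> V1)" "Inr i \<in> g S \<longleftrightarrow> i \<le> r2 (S \<inter> V2)" for i S
      by (auto simp: g_def)
    have g_subset: "g S \<subseteq> g T \<longleftrightarrow> r1 (S \<inter> V1) \<le> r1 (T \<inter> V1) \<and> r2 (S \<inter> V2) \<le> r2 (T \<inter> V2)" for S T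
      unfolding subset_iff split_sum_all g_mem by (meson order.trans order.refl)
    have inj_g: "inj_on g F"
    proof (rule inj_onI)
      fix S T assume ST: "S \<in> F" "T \<in> F" "g S = g T"
      then have "r1 (S \<inter> V1) = r1 (T \<inter> V1)" "r2 (S \<inter> V2) = r2 (T \<inter> V2)"
        using g_subset[of S T] g_subset[of T S] by auto
      then have "S \<inter> V1 = T \<inter> V1" "S \<inter> V2 = T \<inter> V2"
        using r1(1) r2(1) FD ST by (auto dest: inj_onD)
      then show "S = T"
        using FD(3) ST by metis
    qed
    have fibre: "{#S \<in># m. S \<inter> K = j#} = {#S \<in># m'. S \<inter> K = j#}" for j
    proof (rule chain_multiset_eqI[of g])
      show "inj_on g (set_mset {#S \<in># m. S \<inter> K = j#} \<union> set_mset {#S \<in># m'. S \<inter> K = j#})"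
        using inj_g by (rule inj_on_subset) (use std in \<open>auto simp: standard_def\<close>)
      have chain: "g S \<subseteq> g T \<or> g T \<subseteq> g S"
        if n: "standard \<omega> F n" "S \<in># n" "T \<in># n" "S \<inter> K = T \<inter> K" for n S T
      proof (rule ccontr)
        assume "\<not> ?thesis"
        then have "r1 (S \<inter> V1) < r1 (T \<inter> V1) \<and> r2 (T \<inter> V2) < r2 (S \<inter> V2)
            \<or> r1 (T \<inter> V1) < r1 (S \<inter> V1) \<and> r2 (S \<inter> V2) < r2 (T \<inter> V2)"
          unfolding g_subset by linarith
        then have "reducible \<omega> F S T \<or> reducible \<omega> F T S"
          using swap[of S T] swap[of T S] n by (auto simp: standard_def)
        then show False
          using n by (auto simp: standard_def)
      qed
      show "g S \<subseteq> g T \<or> g T \<subseteq> g S"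
        if "S \<in># {#S \<in># m. S \<inter> K = j#}" "T \<in># {#S \<in># m. S \<inter> K = j#}" for S T
        using chain[OF std(1)] that by auto
      show "g S \<subseteq> g T \<or> g T \<subseteq> g S"
        if "S \<in># {#S \<in># m'. S \<inter> K = j#}" "T \<in># {#S \<in># m'. S \<inter> K = j#}" for S T
        using chain[OF std(2)] that by auto
      show "size {#S \<in># {#S \<in># m. S \<inter> K = j#}. b \<in> g S#}
          = size {#S \<in># {#S \<in># m'. S \<inter> K = j#}. b \<in> g S#}" for b
      proof (cases b)
        case (Inl i)
        have "size {#S \<in># {#S \<in># n. S \<inter> K = j#}. b \<in> g S#}
            = size {#A \<in># image_mset (\<lambda>S. S \<inter> V1) n. A \<inter> K = j \<and> i \<le> r1 A#}" for n
          by (auto simp: Inl g_mem filter_mset_image_mset filter_filter_mset K_int conj_commute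
              intro!: arg_cong[where f = size] filter_mset_cong)
        with img1 show ?thesis
          by simp
      next
        case (Inr i)
        have "size {#S \<in># {#S \<in># n. S \<inter> K = j#}. b \<in> g S#}
            = size {#A \<in># image_mset (\<lambda>S. S \<inter> V2) n. A \<inter> K = j \<and> i \<le> r2 A#}" for n
          by (auto simp: Inr g_mem filter_mset_image_mset filter_filter_mset K_int conj_commute
              intro!: arg_cong[where f = size] filter_mset_cong)
        with img2 show ?thesis
          by simp
      qed
    qed (auto simp: g_def)
    show "m = m'"
    proof (rule multiset_eqI)
      fix S
      show "count m S = count m' S"
        using arg_cong[OF fibre[of "S \<inter> K"], of "\<lambda>n. count n S"] by simp
    qed
  qed
  then have "quadratic_weight F \<omega>"
    by (simp add: quadratic_weight_def)
  then show ?thesis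
    unfolding F_def by blast
qed

section \<open>Stable sets of clique separable graphs\<close>

lemma finite_stable_sets: "finite (pverts G) \<Longrightarrow> finite (stable_sets G)"
  by (rule finite_subset[of _ "Pow (pverts G)"]) (auto simp: stable_sets_def)

lemma complete_graphD:
  assumes "complete_graph G"
  shows "finite (pverts G)" "parcs G = {(u, v). u \<in> pverts G \<and> v \<in> pverts G \<and> u \<noteq> v}"
  using assms unfolding complete_graph_def complete_digraph_pair_def by auto

lemma pair_graphD:
  assumes "pair_graph G"
  shows "finite (pverts G)" "parcs G \<subseteq> pverts G \<times> pverts G"
proof -
  interpret pair_graph G
    by fact
  show "finite (pverts G)" "parcs G \<subseteq> pverts G \<times> pverts G"
    using pair_finite_verts in_arcsD1 in_arcsD2 by auto
qed

lemma clique_separable_wf: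
  assumes "clique_separable G"
  shows "finite (pverts G) \<and> parcs G \<subseteq> pverts G \<times> pverts G"
  using assms
proof induction
  case (type1 B C)
  then have "pair_graph B"
    by (simp add: bipartite_graph_def)
  with type1 show ?case
    using pair_graphD[of B] complete_graphD[of C] by (auto simp: graph_join_def)
next
  case (type2 G)
  then show ?case
    using pair_graphD[of G] by (simp add: complete_multipartite_graph_def)
qed (auto simp: graph_union_def)

lemma stable_sets_join_complete:
  assumes "complete_graph C" "pverts B \<inter> pverts C = {}" "parcs B \<subseteq> pverts B \<times> pverts B"
  shows "stable_sets (graph_join B C) = stable_sets B \<union> (\<lambda>c. {c}) ` pverts C"
proof (intro equalityI subsetI)
  fix S assume S: "S \<in> stable_sets (graph_join B C)"
  show "S \<in> stable_sets B \<union> (\<lambda>c. {c}) ` pverts C"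
  proof (cases "S \<inter> pverts C = {}")
    case True
    with S show ?thesis
      by (auto simp: stable_sets_def graph_join_def)
  next
    case False
    then obtain c where c: "c \<in> S" "c \<in> pverts C"
      by blast
    have "v = c" if "v \<in> S" for v
      using S c that complete_graphD(2)[OF assms(1)] by (auto simp: stable_sets_def graph_join_def)
    with c show ?thesis
      by blast
  qed
next
  fix S assume "S \<in> stable_sets B \<union> (\<lambda>c. {c}) ` pverts C"
  then consider "S \<in> stable_sets B" | c where "c \<in> pverts C" "S = {c}"
    by blast
  then show "S \<in> stable_sets (graph_join B C)"
  proof cases
    case 1
    then have S: "S \<subseteq> pverts B" "\<And>u v. u \<in> S \<Longrightarrow> v \<in> S \<Longrightarrow> u \<noteq> v \<Longrightarrow> (u, v) \<notin> parcs B"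
      by (auto simp: stable_sets_def)
    have "(u, v) \<notin> parcs (graph_join B C)" if "u \<in> S" "v \<in> S" "u \<noteq> v" for u v
    proof -
      have "u \<notin> pverts C" "v \<notin> pverts C"
        using S(1) that assms(2) by auto
      then show ?thesis
        using S(2)[OF that] complete_graphD(2)[OF assms(1)] by (simp add: graph_join_def)
    qed
    with S(1) show ?thesis
      by (auto simp: stable_sets_def graph_join_def)
  qed (simp add: stable_sets_def graph_join_def)
qed

lemma stable_sets_complete_multipartite:
  assumes "partition_on (pverts G) P"
    and "parcs G = {(u, v). u \<in> pverts G \<and> v \<in> pverts G \<and> \<not> (\<exists>p\<in>P. u \<in> p \<and> v \<in> p)}"
  shows "stable_sets G = insert {} (\<Union>p\<in>P. Pow p)"
proof (intro equalityI subsetI)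
  fix S assume S: "S \<in> stable_sets G"
  show "S \<in> insert {} (\<Union>p\<in>P. Pow p)"
  proof (cases "S = {}")
    case False
    then obtain u where u: "u \<in> S"
      by blast
    with S obtain p where p: "p \<in> P" "u \<in> p"
      using partition_onD1[OF assms(1)] by (auto simp: stable_sets_def)
    have "v \<in> p" if "v \<in> S" for v
    proof (cases "v = u")
      case False
      have "u \<in> pverts G" "v \<in> pverts G" "(u, v) \<notin> parcs G"
        using S u that False by (auto simp: stable_sets_def)
      then obtain q where "q \<in> P" "u \<in> q" "v \<in> q"
        unfolding assms(2) by blast
      with p show ?thesis
        using partition_onD2[OF assms(1)] by (auto simp: disjoint_def)
    qed (use p in simp)
    with p show ?thesis
      by blast
  qed simp
next
  fix S assume "S \<in> insert {} (\<Union>p\<in>P. Pow p)"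
  then consider "S = {}" | p where "p \<in> P" "S \<subseteq> p"
    by blast
  then show "S \<in> stable_sets G"
  proof cases
    case 2
    then have "S \<subseteq> pverts G"
      using partition_onD1[OF assms(1)] by blast
    moreover have "(u, v) \<notin> parcs G" if "u \<in> S" "v \<in> S" for u v
      using 2 that by (auto simp: assms(2))
    ultimately show ?thesis
      by (simp add: stable_sets_def)
  qed (simp add: stable_sets_def)
qed

lemma stable_sets_union:
  assumes "parcs G \<subseteq> pverts G \<times> pverts G" "parcs H \<subseteq> pverts H \<times> pverts H"
  shows "stable_sets (graph_union G H) =
    {S. S \<subseteq> pverts G \<union> pverts H \<and> S \<inter> pverts G \<in> stable_sets G \<and> S \<inter> pverts H \<in> stable_sets H}"
  using assms unfolding stable_sets_def graph_union_def by auto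

lemma clique_separable_quadratic_weight:
  assumes "clique_separable G"
  shows "\<exists>\<omega>. quadratic_weight (stable_sets G) \<omega>"
  using assms
proof induction
  case (type1 B C)
  then obtain U W where UW: "pverts B = U \<union> W" "U \<inter> W = {}" "parcs B \<subseteq> U \<times> W \<union> W \<times> U"
    and "pair_graph B"
    by (auto simp: bipartite_graph_def)
  note wf = pair_graphD[OF \<open>pair_graph B\<close>]
  have "quadratic_weight (stable_sets (graph_join B C))
    (\<lambda>S. (card (pverts B))\<^sup>2 - (card (sym_diff S W))\<^sup>2)"
  proof (rule quadratic_weight_lattice_join)
    show "stable_sets (graph_join B C) = stable_sets B \<union> (\<lambda>c. {c}) ` pverts C"
      using stable_sets_join_complete type1 wf(2) by blast
    fix S T assume ST: "S \<in> stable_sets B" "T \<in> stable_sets B"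
    then have sub: "S \<subseteq> U \<union> W" "T \<subseteq> U \<union> W"
      by (auto simp: stable_sets_def UW)
    have nonadjacent: "(x, y) \<notin> parcs B" if "Z \<in> stable_sets B" "x \<in> Z" "y \<in> Z" "x \<noteq> y" for x y Z
      using that by (auto simp: stable_sets_def)
    \<comment> \<open>In the meet and in the join, an element of \<open>U\<close> and one of \<open>W\<close> come from a common set.\<close>
    have stable: "X \<in> stable_sets B"
      if X: "X \<subseteq> U \<union> W" "\<And>u w. u \<in> X \<inter> U \<Longrightarrow> w \<in> X \<inter> W \<Longrightarrow> u \<in> S \<and> w \<in> S \<or> u \<in> T \<and> w \<in> T" for X
    proof -
      have "(u, w) \<notin> parcs B \<and> (w, u) \<notin> parcs B" if "u \<in> X \<inter> U" "w \<in> X \<inter> W" for u w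
      proof -
        have "u \<noteq> w"
          using that UW(2) by blast
        then show ?thesis
          using X(2)[OF that] ST nonadjacent by metis
      qed
      then have "(x, y) \<notin> parcs B" if "x \<in> X" "y \<in> X" for x y
        using that UW(3) by blast
      then show ?thesis
        using X(1) UW(1) by (simp add: stable_sets_def)
    qed
    show "sym_diff (sym_diff S W \<inter> sym_diff T W) W \<in> stable_sets B"
      using sub UW(2) by (intro stable) auto
    show "sym_diff (sym_diff S W \<union> sym_diff T W) W \<in> stable_sets B"
      using sub UW(2) by (intro stable) auto
  qed (use type1 wf complete_graphD UW in \<open>auto simp: stable_sets_def\<close>)
  then show ?case
    by blast
next
  case (type2 G)
  then obtain P where P: "partition_on (pverts G) P"
    "parcs G = {(u, v). u \<in> pverts G \<and> v \<in> pverts G \<and> \<not> (\<exists>p\<in>P. u \<in> p \<and> v \<in> p)}"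
    and "pair_graph G"
    unfolding complete_multipartite_graph_def by blast
  then show ?case
    unfolding stable_sets_complete_multipartite[OF P]
    using quadratic_weight_multipartite[OF pair_graphD(1)] by blast
next
  case (glue H1 H2)
  note wf1 = clique_separable_wf[OF glue.hyps(1)] and wf2 = clique_separable_wf[OF glue.hyps(2)]
  have clique: "(u, v) \<in> parcs H1 \<and> (u, v) \<in> parcs H2"
    if "u \<in> pverts H1 \<inter> pverts H2" "v \<in> pverts H1 \<inter> pverts H2" "u \<noteq> v" for u v
  proof -
    have "(u, v) \<in> parcs (graph_inter H1 H2)"
      using complete_graphD(2)[OF glue.hyps(3)] that by (simp add: graph_inter_def)
    then show ?thesis
      by (simp add: graph_inter_def)
  qed
  have stable_clique: "u = v"
    if "S \<in> stable_sets H1 \<or> S \<in> stable_sets H2"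
      and "u \<in> S \<inter> (pverts H1 \<inter> pverts H2)" "v \<in> S \<inter> (pverts H1 \<inter> pverts H2)" for S u v
    using clique[of u v] that unfolding stable_sets_def by blast
  obtain \<omega>1 \<omega>2 where
    \<omega>: "quadratic_weight (stable_sets H1) \<omega>1" "quadratic_weight (stable_sets H2) \<omega>2"
    using glue.IH by blast
  show ?case
    unfolding stable_sets_union[OF conjunct2[OF wf1] conjunct2[OF wf2]]
  proof (rule quadratic_weight_glue[OF _ _ \<omega>(1) _ _ \<omega>(2)])
    show "finite (stable_sets H1)" "finite (stable_sets H2)"
      using wf1 wf2 finite_stable_sets by blast+
    show "stable_sets H1 \<subseteq> Pow (pverts H1)" "stable_sets H2 \<subseteq> Pow (pverts H2)"
      by (auto simp: stable_sets_def)
  qed (use stable_clique in blast)+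
qed

section \<open>Monomials as multisets\<close>

text \<open>The multiset of variables of a monomial, with their exponents as multiplicities.\<close>

definition monomial_mset :: "('i \<Rightarrow>\<^sub>0 nat) \<Rightarrow> 'i multiset" where
  "monomial_mset u = Abs_multiset (Poly_Mapping.lookup u)"

text \<open>The product of the variables in a multiset, inverse to \<open>monomial_mset\<close>.\<close>

definition mset_monomial :: "'i multiset \<Rightarrow> 'i \<Rightarrow>\<^sub>0 nat" where
  "mset_monomial m = (\<Sum>i\<in>#m. Poly_Mapping.single i 1)"

lemma lookup_sum_mset:
  "Poly_Mapping.lookup (\<Sum>x\<in>#m. f x) i = (\<Sum>x\<in>#m. Poly_Mapping.lookup (f x) i)"
  by (induction m) (simp_all add: lookup_add)

lemma count_monomial_mset [simp]: "count (monomial_mset u) = Poly_Mapping.lookup u"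
proof -
  have "finite {i. 0 < Poly_Mapping.lookup u i}"
    by simp
  then show ?thesis
    unfolding monomial_mset_def by (rule count_Abs_multiset)
qed

lemma lookup_mset_monomial [simp]: "Poly_Mapping.lookup (mset_monomial m) = count m"
proof
  show "Poly_Mapping.lookup (mset_monomial m) i = count m i" for i
    unfolding mset_monomial_def lookup_sum_mset
    by (induction m) (simp_all add: lookup_single when_def)
qed

lemma monomial_mset_inverse [simp]: "mset_monomial (monomial_mset u) = u"
  by (simp add: poly_mapping_eq_iff)

lemma mset_monomial_inverse [simp]: "monomial_mset (mset_monomial m) = m"
  by (simp add: multiset_eq_iff)

lemma set_monomial_mset [simp]: "set_mset (monomial_mset u) = Poly_Mapping.keys u"
  by (auto simp: set_mset_def in_keys_iff)

lemma keys_mset_monomial [simp]: "Poly_Mapping.keys (mset_monomial m) = set_mset m"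
  by (metis mset_monomial_inverse set_monomial_mset)

lemma monomial_mset_zero [simp]: "monomial_mset 0 = {#}"
  by (simp add: multiset_eq_iff)

lemma monomial_mset_plus [simp]: "monomial_mset (u + v) = monomial_mset u + monomial_mset v"
  by (simp add: multiset_eq_iff lookup_add)

lemma mset_monomial_union: "mset_monomial (m + n) = mset_monomial m + mset_monomial n"
  by (simp add: mset_monomial_def)

lemma monomial_degree_mset: "monomial_degree (mset_monomial m) = size m"
  by (simp add: monomial_degree_def size_multiset_overloaded_eq)

section \<open>Monomial orders refining a weight\<close>

text \<open>
  The order is the pullback of the lexicographic order on exponent vectors indexed by the
  natural numbers, with the weight as the entry at \<open>0\<close>.
\<close>

lemma ex_monomial_order_weight:
  fixes X :: "'i set" and \<omega> :: "'i \<Rightarrow> nat"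
  assumes "finite X"
  obtains r where "monomial_order X r"
    and "\<And>u v. u \<in> monomials X \<Longrightarrow> v \<in> monomials X \<Longrightarrow>
           (\<Sum>x\<in>#monomial_mset u. \<omega> x) < (\<Sum>x\<in>#monomial_mset v. \<omega> x) \<Longrightarrow> (u, v) \<in> r - Id"
proof -
  obtain e :: "'i \<Rightarrow> nat" where e: "inj_on e X"
    using finite_imp_inj_to_nat_seg[OF assms] by metis
  define \<phi> :: "('i \<Rightarrow>\<^sub>0 nat) \<Rightarrow> (nat \<Rightarrow>\<^sub>0 nat)"
    where "\<phi> u = (\<Sum>x\<in>#monomial_mset u.
      Poly_Mapping.single 0 (\<omega> x) + Poly_Mapping.single (Suc (e x)) 1)" for u
  have \<phi>_add: "\<phi> (u + v) = \<phi> u + \<phi> v" for u v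
    by (simp add: \<phi>_def)
  have \<phi>_0: "Poly_Mapping.lookup (\<phi> u) 0 = (\<Sum>x\<in>#monomial_mset u. \<omega> x)" for u
    by (simp add: \<phi>_def lookup_sum_mset lookup_add lookup_single when_def)
  have \<phi>_Suc: "Poly_Mapping.lookup (\<phi> u) (Suc (e x)) = Poly_Mapping.lookup u x"
    if "u \<in> monomials X" "x \<in> X" for u x
  proof -
    have count_sum: "(\<Sum>y\<in>#m. if y = x then 1 else 0) = count m x" for m
      by (induction m) auto
    have "Poly_Mapping.lookup (\<phi> u) (Suc (e x)) = (\<Sum>y\<in>#monomial_mset u. if e y = e x then 1 else 0)"
      by (simp add: \<phi>_def lookup_sum_mset lookup_add lookup_single when_def cong: if_cong)
    also have "\<dots> = (\<Sum>y\<in>#monomial_mset u. if y = x then 1 else 0)"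
      using that e by (intro arg_cong[where f = sum_mset] image_mset_cong)
        (auto simp: monomials_def dest: inj_onD)
    also have "\<dots> = count (monomial_mset u) x"
      by (rule count_sum)
    finally show ?thesis
      by simp
  qed
  have \<phi>_inj: "u = v" if "u \<in> monomials X" "v \<in> monomials X" "\<phi> u = \<phi> v" for u v
  proof (rule poly_mapping_eqI)
    fix x
    show "Poly_Mapping.lookup u x = Poly_Mapping.lookup v x"
    proof (cases "x \<in> X")
      case True
      then show ?thesis
        using that \<phi>_Suc by metis
    next
      case False
      with that have "x \<notin> Poly_Mapping.keys u" "x \<notin> Poly_Mapping.keys v"
        by (auto simp: monomials_def)
      then show ?thesis
        by (simp add: in_keys_iff)
    qed
  qed
  have nonneg: "0 \<le> f" for f :: "nat \<Rightarrow>\<^sub>0 nat"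
  proof -
    have "\<not> f < 0"
      by transfer (auto simp: less_fun_def)
    then show ?thesis
      by simp
  qed
  define r where "r = {(u, v). u \<in> monomials X \<and> v \<in> monomials X \<and> \<phi> u \<le> \<phi> v}"
  have "linear_order_on (monomials X) r"
    unfolding linear_order_on_def partial_order_on_def preorder_on_def
    using \<phi>_inj by (auto simp: r_def refl_on_def total_on_def intro!: antisymI transI)
  moreover have "(0, u) \<in> r" if "u \<in> monomials X" for u
  proof -
    have "\<phi> 0 = 0"
      by (simp add: \<phi>_def)
    with that nonneg show ?thesis
      by (simp add: r_def monomials_def)
  qed
  moreover have "(u + w, v + w) \<in> r - Id"
    if "u \<in> monomials X" "v \<in> monomials X" "w \<in> monomials X" "(u, v) \<in> r - Id" for u v w
    using that Poly_Mapping.keys_add[of u w] Poly_Mapping.keys_add[of v w]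
    by (auto simp: r_def \<phi>_add monomials_def intro: add_right_mono)
  ultimately have "monomial_order X r"
    by (simp add: monomial_order_def)
  moreover have "(u, v) \<in> r - Id"
    if "u \<in> monomials X" "v \<in> monomials X"
      and "(\<Sum>x\<in>#monomial_mset u. \<omega> x) < (\<Sum>x\<in>#monomial_mset v. \<omega> x)" for u v
  proof -
    have "Poly_Mapping.lookup (\<phi> u) 0 < Poly_Mapping.lookup (\<phi> v) 0"
      using that by (simp add: \<phi>_0)
    then have "\<phi> u < \<phi> v"
      by transfer (auto simp: less_fun_def)
    then show ?thesis
      using that by (auto simp: r_def)
  qed
  ultimately show ?thesis
    using that by blast
qed

lemma linear_order_on_ex_greatest:
  assumes "linear_order_on A r" "finite K" "K \<noteq> {}" "K \<subseteq> A"
  shows "\<exists>u\<in>K. \<forall>v\<in>K. (v, u) \<in> r"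
  using assms(2-4)
proof (induction K rule: finite_ne_induct)
  case (singleton x)
  then show ?case
    using assms(1) by (auto simp: order_on_defs refl_on_def)
next
  case (insert x K)
  then obtain u where u: "u \<in> K" "\<forall>v\<in>K. (v, u) \<in> r"
    by auto
  have "(x, u) \<in> r \<or> (u, x) \<in> r" "(x, x) \<in> r"
    using assms(1) insert u by (auto simp: order_on_defs refl_on_def total_on_def)
  moreover have "trans r"
    using assms(1) by (simp add: order_on_defs)
  ultimately show ?case
    using u by (auto dest: transD)
qed

lemma initial_monomial_eqI:
  assumes "monomial_order X r"
    and "u \<in> Poly_Mapping.keys f" "\<And>v. v \<in> Poly_Mapping.keys f \<Longrightarrow> (v, u) \<in> r"
  shows "initial_monomial r f = u"
  unfolding initial_monomial_def
proof (rule the_equality)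
  fix v assume "v \<in> Poly_Mapping.keys f \<and> (\<forall>w\<in>Poly_Mapping.keys f. (w, v) \<in> r)"
  then show "v = u"
    using assms by (auto simp: monomial_order_def order_on_defs dest: antisymD)
qed (use assms in blast)

lemma initial_monomial_greatest:
  assumes "monomial_order X r" "Poly_Mapping.keys f \<subseteq> monomials X" "f \<noteq> 0"
  shows "initial_monomial r f \<in> Poly_Mapping.keys f"
    and "v \<in> Poly_Mapping.keys f \<Longrightarrow> (v, initial_monomial r f) \<in> r"
proof -
  obtain u where "u \<in> Poly_Mapping.keys f" "\<forall>v\<in>Poly_Mapping.keys f. (v, u) \<in> r"
    using linear_order_on_ex_greatest[of "monomials X" r "Poly_Mapping.keys f"] assms
    by (auto simp: monomial_order_def)
  moreover from this have "initial_monomial r f = u"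
    using assms(1) by (intro initial_monomial_eqI) auto
  ultimately show "initial_monomial r f \<in> Poly_Mapping.keys f"
    and "v \<in> Poly_Mapping.keys f \<Longrightarrow> (v, initial_monomial r f) \<in> r"
    by auto
qed

section \<open>The toric ideal\<close>

lemma monom_poly_mult: "monom_poly u * monom_poly v = monom_poly (u + v)"
  by (simp add: monom_poly_def mult_single)

lemma monom_poly_0: "monom_poly 0 = 1"
  by (simp add: monom_poly_def)

lemma monom_poly_sum: "finite A \<Longrightarrow> monom_poly (\<Sum>x\<in>A. f x) = (\<Prod>x\<in>A. monom_poly (f x))"
  by (induction A rule: finite_induct) (simp_all add: monom_poly_0 flip: monom_poly_mult)

lemma monom_poly_sum_mset: "monom_poly (\<Sum>x\<in>#m. f x) = (\<Prod>x\<in>#m. monom_poly (f x))"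
  by (induction m) (simp_all add: monom_poly_0 flip: monom_poly_mult)

lemma var_poly_power: "var_poly i ^ k = monom_poly (Poly_Mapping.single i k)"
  by (induction k) (simp_all add: var_poly_def monom_poly_0 monom_poly_mult flip: single_add)

text \<open>The exponent vector of the image of the monomial \<open>m\<close> under the toric map.\<close>

definition toric_exponent :: "'v pair_pre_digraph \<Rightarrow> 'v set multiset \<Rightarrow> 'v option \<Rightarrow>\<^sub>0 nat" where
  "toric_exponent G m =
     (\<Sum>S\<in>#m. (\<Sum>j\<in>pverts G. Poly_Mapping.single (Some j) (Poly_Mapping.lookup (rho S) j))
        + Poly_Mapping.single None 1)"

lemma toric_map_eq:
  assumes "finite (pverts G)"
  shows "toric_map G f =
    (\<Sum>u\<in>Poly_Mapping.keys f.
       Poly_Mapping.single (toric_exponent G (monomial_mset u)) (Poly_Mapping.lookup f u))"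
proof -
  let ?g = "\<lambda>S. (\<Prod>j\<in>pverts G. var_poly (Some j) ^ Poly_Mapping.lookup (rho S) j)
      * var_poly None :: ('a option \<Rightarrow>\<^sub>0 nat) \<Rightarrow>\<^sub>0 'b"
  have "(\<Prod>S\<in>Poly_Mapping.keys u. ?g S ^ Poly_Mapping.lookup u S)
      = monom_poly (toric_exponent G (monomial_mset u))" for u
  proof -
    have "(\<Prod>S\<in>Poly_Mapping.keys u. ?g S ^ Poly_Mapping.lookup u S) = (\<Prod>S\<in>#monomial_mset u. ?g S)"
      by (simp add: image_prod_mset_multiplicity)
    also have "\<dots> = monom_poly (toric_exponent G (monomial_mset u))"
      unfolding toric_exponent_def monom_poly_sum_mset monom_poly_mult[symmetric] monom_poly_sum[OF assms]
      by (simp add: var_poly_power) (simp add: var_poly_def)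
    finally show ?thesis .
  qed
  then show ?thesis
    by (simp add: toric_map_def subst_poly_def const_poly_def monom_poly_def mult_single)
qed

lemma lookup_rho: "finite S \<Longrightarrow> Poly_Mapping.lookup (rho S) v = of_bool (v \<in> S)"
  by (simp add: rho_def lookup_sum lookup_single when_def)

lemma toric_exponent_eq_iff:
  assumes "finite (pverts G)" "set_mset m \<subseteq> stable_sets G" "set_mset m' \<subseteq> stable_sets G"
  shows "toric_exponent G m = toric_exponent G m' \<longleftrightarrow> same_degree m m'"
proof -
  have None: "Poly_Mapping.lookup (toric_exponent G m) None = size m" for m
    by (simp add: toric_exponent_def lookup_sum_mset lookup_add lookup_sum lookup_single when_def)
  have Some: "Poly_Mapping.lookup (toric_exponent G m) (Some v) = vertex_degree v m"
    if m: "set_mset m \<subseteq> stable_sets G" for m v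
  proof -
    have "Poly_Mapping.lookup (\<Sum>j\<in>pverts G. Poly_Mapping.single (Some j) (Poly_Mapping.lookup (rho S) j)) (Some v)
        = of_bool (v \<in> S)" if "S \<in># m" for S
    proof -
      have "S \<subseteq> pverts G"
        using that m by (auto simp: stable_sets_def)
      then show ?thesis
        using assms(1) finite_subset[OF \<open>S \<subseteq> pverts G\<close> assms(1)]
        by (auto simp: lookup_sum lookup_single when_def lookup_rho)
    qed
    then have "Poly_Mapping.lookup (toric_exponent G m) (Some v) = (\<Sum>S\<in>#m. of_bool (v \<in> S))"
      unfolding toric_exponent_def lookup_sum_mset
      by (intro arg_cong[where f = sum_mset] image_mset_cong) (simp add: lookup_add lookup_single)
    also have "\<dots> = vertex_degree v m"
      by (induction m) (simp_all add: vertex_degree_def)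
    finally show ?thesis .
  qed
  have "toric_exponent G m = toric_exponent G m' \<longleftrightarrow>
      (\<forall>i. Poly_Mapping.lookup (toric_exponent G m) i = Poly_Mapping.lookup (toric_exponent G m') i)"
    by (simp add: poly_mapping_eq_iff fun_eq_iff)
  then show ?thesis
    by (simp add: split_option_all None Some[OF assms(2)] Some[OF assms(3)] same_degree_def)
qed

lemma toric_ideal_keys:
  "f \<in> toric_ideal G \<Longrightarrow> Poly_Mapping.keys f \<subseteq> monomials (stable_sets G)"
  by (simp add: toric_ideal_def a_kernel_def')

text \<open>The coefficients of an element of the toric ideal in each degree add up to zero.\<close>

lemma toric_ideal_same_degree:
  fixes f :: "('v set \<Rightarrow>\<^sub>0 nat) \<Rightarrow>\<^sub>0 'k::field"
  assumes "finite (pverts G)" "f \<in> toric_ideal G" "u \<in> Poly_Mapping.keys f"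
  shows "\<exists>v\<in>Poly_Mapping.keys f. v \<noteq> u \<and> same_degree (monomial_mset u) (monomial_mset v)"
proof (rule ccontr)
  assume none: "\<not> ?thesis"
  let ?w = "\<lambda>u. toric_exponent G (monomial_mset u)"
  have "?w v \<noteq> ?w u" if "v \<in> Poly_Mapping.keys f" "v \<noteq> u" for v
  proof -
    have "\<not> same_degree (monomial_mset v) (monomial_mset u)"
      using none that same_degree_sym by blast
    then show ?thesis
      using that assms toric_ideal_keys[OF assms(2)]
      by (subst toric_exponent_eq_iff) (auto simp: monomials_def)
  qed
  then have "Poly_Mapping.lookup (toric_map G f) (?w u)
      = (\<Sum>v\<in>Poly_Mapping.keys f. if v = u then Poly_Mapping.lookup f v else 0)"
    unfolding toric_map_eq[OF assms(1)] lookup_sum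
    by (intro sum.cong) (auto simp: lookup_single when_def)
  also have "\<dots> = Poly_Mapping.lookup f u"
    using assms(3) by simp
  also have "toric_map G f = 0"
    using assms(2) by (simp add: toric_ideal_def a_kernel_def')
  finally show False
    using assms(3) by (simp add: in_keys_iff)
qed

lemma binomial_in_toric_ideal:
  assumes "finite (pverts G)" "u \<in> monomials (stable_sets G)" "v \<in> monomials (stable_sets G)"
    and "same_degree (monomial_mset u) (monomial_mset v)" "u \<noteq> v"
  shows "monom_poly u - monom_poly v \<in> (toric_ideal G :: (_ \<Rightarrow>\<^sub>0 'k::field) set)"
    and "Poly_Mapping.keys (monom_poly u - monom_poly v :: _ \<Rightarrow>\<^sub>0 'k) = {u, v}"
proof -
  let ?f = "monom_poly u - monom_poly v :: _ \<Rightarrow>\<^sub>0 'k"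
  have lookup: "Poly_Mapping.lookup ?f w = (if w = u then 1 else if w = v then - 1 else 0)" for w
    using assms(5) by (auto simp: monom_poly_def lookup_minus lookup_single when_def)
  then show keys: "Poly_Mapping.keys ?f = {u, v}"
    by (auto simp: in_keys_iff lookup split: if_splits)
  have "toric_exponent G (monomial_mset u) = toric_exponent G (monomial_mset v)"
    using assms by (subst toric_exponent_eq_iff) (auto simp: monomials_def)
  then have "toric_map G ?f = 0"
    unfolding toric_map_eq[OF assms(1)] keys using assms(5) by (simp add: lookup flip: single_add)
  then show "?f \<in> toric_ideal G"
    using assms keys by (simp add: toric_ideal_def a_kernel_def')
qed

section \<open>The initial ideal\<close>

lemma ex_remove_pair:
  assumes "x \<in># m" "y \<in># m" "x \<noteq> y"
  shows "\<exists>k. m = {#x, y#} + k"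
proof -
  obtain n where n: "m = add_mset x n"
    using multi_member_split[OF assms(1)] by blast
  with assms have "y \<in># n"
    by simp
  then obtain k where "n = add_mset y k"
    using multi_member_split by metis
  with n show ?thesis
    by simp
qed

text \<open>Replacing reducible pairs terminates, because each replacement decreases the weight.\<close>

lemma ex_standard:
  assumes "set_mset m \<subseteq> F"
  shows "\<exists>m'. standard \<omega> F m' \<and> same_degree m m' \<and> (m' = m \<or> (\<Sum>S\<in>#m'. \<omega> S) < (\<Sum>S\<in>#m. \<omega> S))"
  using assms
proof (induction "\<Sum>S\<in>#m. \<omega> S" arbitrary: m rule: less_induct)
  case less
  show ?case
  proof (cases "standard \<omega> F m")
    case False
    then obtain S T where ST: "S \<in># m" "T \<in># m" "reducible \<omega> F S T"
      using less.prems by (auto simp: standard_def)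
    then have "S \<noteq> T"
      using not_reducible_self by blast
    with ST obtain k where k: "m = {#S, T#} + k"
      using ex_remove_pair by metis
    obtain S' T' where ST': "S' \<in> F" "T' \<in> F" "same_degree {#S, T#} {#S', T'#}" "\<omega> S' + \<omega> T' < \<omega> S + \<omega> T"
      using ST(3) by (auto simp: reducible_def)
    let ?n = "{#S', T'#} + k"
    have less_n: "(\<Sum>S\<in>#?n. \<omega> S) < (\<Sum>S\<in>#m. \<omega> S)"
      using ST'(4) by (simp add: k)
    have deg_n: "same_degree m ?n"
      unfolding k using ST'(3) by (rule same_degree_union) simp
    have "set_mset ?n \<subseteq> F"
      using less.prems ST' by (simp add: k)
    from less.hyps[OF less_n this] obtain m' where m': "standard \<omega> F m'" "same_degree ?n m'"
      "m' = ?n \<or> (\<Sum>S\<in>#m'. \<omega> S) < (\<Sum>S\<in>#?n. \<omega> S)"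
      by blast
    then have "(\<Sum>S\<in>#m'. \<omega> S) < (\<Sum>S\<in>#m. \<omega> S)"
      using less_n by auto
    with m'(1) same_degree_trans[OF deg_n m'(2)] show ?thesis
      by blast
  qed auto
qed

lemma monomial_ideal_subsetI:
  assumes "M \<subseteq> monomials X" "\<And>u. u \<in> N \<Longrightarrow> \<exists>w\<in>monomials X. \<exists>v\<in>M. u = v + w"
  shows "monomial_ideal X N \<subseteq> (monomial_ideal X M :: (_ \<Rightarrow>\<^sub>0 'k::comm_ring_1) set)"
proof -
  interpret cring "mpoly_ring X :: (('a \<Rightarrow>\<^sub>0 nat) \<Rightarrow>\<^sub>0 'k) ring"
    by (rule cring_mpoly_ring)
  have carrier: "monom_poly u \<in> carrier (mpoly_ring X)" if "u \<in> monomials X" for u :: "'a \<Rightarrow>\<^sub>0 nat"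
    using that by (simp add: monom_poly_def)
  have sub: "monom_poly ` M \<subseteq> carrier (mpoly_ring X :: (('a \<Rightarrow>\<^sub>0 nat) \<Rightarrow>\<^sub>0 'k) ring)"
    using assms(1) carrier by blast
  let ?J = "Idl\<^bsub>mpoly_ring X\<^esub> (monom_poly ` M :: (('a \<Rightarrow>\<^sub>0 nat) \<Rightarrow>\<^sub>0 'k) set)"
  have ideal: "ideal ?J (mpoly_ring X)"
    using sub by (rule genideal_ideal)
  have "monom_poly ` N \<subseteq> ?J"
  proof (rule image_subsetI)
    fix u assume "u \<in> N"
    then obtain v w where vw: "v \<in> M" "w \<in> monomials X" "u = v + w"
      using assms(2) by blast
    have "monom_poly v \<in> ?J"
      using genideal_self[OF sub] vw(1) by blast
    then have "monom_poly v * monom_poly w \<in> ?J"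
      using ideal.I_r_closed[OF ideal _ carrier[OF vw(2)], of "monom_poly v"] by simp
    then show "monom_poly u \<in> ?J"
      by (simp add: vw(3) monom_poly_mult)
  qed
  then show ?thesis
    unfolding monomial_ideal_def by (rule genideal_minimal[OF ideal])
qed

lemma quadratic_weight_initial_ideal:
  fixes G :: "'v pair_pre_digraph"
  assumes fin: "finite (pverts G)" and \<omega>: "quadratic_weight (stable_sets G) \<omega>"
  shows "\<exists>r. monomial_order (stable_sets G) r \<and>
    squarefree_quadratic_ideal (stable_sets G)
      (initial_ideal (stable_sets G) r (toric_ideal G :: (('v set \<Rightarrow>\<^sub>0 nat) \<Rightarrow>\<^sub>0 'k::field) set))"
proof -
  define X where "X = stable_sets G"
  define I where "I = (toric_ideal G :: (('v set \<Rightarrow>\<^sub>0 nat) \<Rightarrow>\<^sub>0 'k) set)"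
  have "finite X"
    unfolding X_def using fin by (rule finite_stable_sets)
  then obtain r where r: "monomial_order X r"
    and r_less: "\<And>u v. u \<in> monomials X \<Longrightarrow> v \<in> monomials X \<Longrightarrow>
           (\<Sum>S\<in>#monomial_mset u. \<omega> S) < (\<Sum>S\<in>#monomial_mset v. \<omega> S) \<Longrightarrow> (u, v) \<in> r - Id"
    using ex_monomial_order_weight[of X \<omega>] by blast
  define M where "M = {mset_monomial {#S, T#} |S T. S \<in> X \<and> T \<in> X \<and> reducible \<omega> X S T}"
  define N where "N = {initial_monomial r f |f. f \<in> I \<and> f \<noteq> 0}"
  have "M \<subseteq> monomials X"
    by (auto simp: M_def monomials_def)
  have "squarefree_monomial u \<and> monomial_degree u = 2" if "u \<in> M" for u
    using that by (auto simp: M_def squarefree_monomial_def monomial_degree_mset not_reducible_self)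
  have N_sub: "N \<subseteq> monomials X"
  proof
    fix u assume "u \<in> N"
    then obtain f where f: "f \<in> I" "f \<noteq> 0" "u = initial_monomial r f"
      unfolding N_def by blast
    have "Poly_Mapping.keys f \<subseteq> monomials X"
      using toric_ideal_keys f(1) unfolding I_def X_def .
    then show "u \<in> monomials X"
      using initial_monomial_greatest(1)[OF r _ f(2)] f(3) by blast
  qed
  have "M \<subseteq> N"
  proof
    fix u assume "u \<in> M"
    then obtain S T S' T' where u: "u = mset_monomial {#S, T#}" "S \<in> X" "T \<in> X" "S' \<in> X" "T' \<in> X"
      and deg: "same_degree {#S, T#} {#S', T'#}" and less: "\<omega> S' + \<omega> T' < \<omega> S + \<omega> T"
      by (auto simp: M_def reducible_def)
    define v where "v = mset_monomial {#S', T'#}"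
    have uv: "u \<in> monomials X" "v \<in> monomials X"
      using u by (auto simp: v_def monomials_def)
    have vu: "(v, u) \<in> r - Id"
      using less by (intro r_less uv) (simp add: u(1) v_def)
    let ?f = "monom_poly u - monom_poly v :: _ \<Rightarrow>\<^sub>0 'k"
    have "same_degree (monomial_mset u) (monomial_mset v)" "u \<noteq> v"
      using deg vu by (auto simp: u(1) v_def)
    note f = binomial_in_toric_ideal[OF fin uv[unfolded X_def] this, where 'k = 'k, folded I_def]
    have "(u, u) \<in> r"
      using r uv by (auto simp: monomial_order_def order_on_defs refl_on_def)
    then have "initial_monomial r ?f = u"
      using vu by (intro initial_monomial_eqI[OF r]) (auto simp: f(2))
    moreover have "?f \<noteq> 0"
      using f(2) by auto
    ultimately show "u \<in> N"
      using f(1) unfolding N_def by (intro CollectI exI[of _ ?f] conjI) simp_all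
  qed
  have "\<exists>w\<in>monomials X. \<exists>v\<in>M. u = v + w" if u_N: "u \<in> N" for u
  proof -
    obtain f where f: "f \<in> I" "f \<noteq> 0" "u = initial_monomial r f"
      using u_N unfolding N_def by blast
    have keys: "Poly_Mapping.keys f \<subseteq> monomials X"
      using toric_ideal_keys f(1) unfolding I_def X_def .
    note u = initial_monomial_greatest[OF r keys f(2), folded f(3)]
    obtain v where v: "v \<in> Poly_Mapping.keys f" "v \<noteq> u" "same_degree (monomial_mset u) (monomial_mset v)"
      using toric_ideal_same_degree[OF fin] f(1) u(1) unfolding I_def by blast
    have uv: "u \<in> monomials X" "v \<in> monomials X"
      using keys u(1) v(1) by auto
    have "\<not> standard \<omega> X (monomial_mset u)"
    proof
      assume std: "standard \<omega> X (monomial_mset u)"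
      obtain m where m: "standard \<omega> X m" "same_degree (monomial_mset v) m"
        "m = monomial_mset v \<or> (\<Sum>S\<in>#m. \<omega> S) < (\<Sum>S\<in>#monomial_mset v. \<omega> S)"
        using ex_standard[of "monomial_mset v" X \<omega>] uv(2) by (auto simp: monomials_def)
      have "m = monomial_mset u"
        using \<omega> std m(1) same_degree_trans[OF v(3) m(2)] unfolding quadratic_weight_def X_def by metis
      then have "u = v \<or> (u, v) \<in> r - Id"
        using m(3) r_less[OF uv] by (metis monomial_mset_inverse)
      then show False
        using u(2)[OF v(1)] v(2) r by (auto simp: monomial_order_def order_on_defs dest: antisymD)
    qed
    then obtain S T where ST: "S \<in># monomial_mset u" "T \<in># monomial_mset u" "reducible \<omega> X S T"
      using uv(1) by (auto simp: standard_def monomials_def)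
    then have "S \<noteq> T"
      using not_reducible_self by blast
    with ST obtain k where k: "monomial_mset u = {#S, T#} + k"
      using ex_remove_pair by metis
    have "u = mset_monomial {#S, T#} + mset_monomial k"
      by (metis k monomial_mset_inverse mset_monomial_union)
    moreover have sub: "set_mset (monomial_mset u) \<subseteq> X"
      using uv(1) by (simp add: monomials_def)
    moreover have "mset_monomial {#S, T#} \<in> M"
      using ST sub unfolding M_def by blast
    moreover have "mset_monomial k \<in> monomials X"
      using sub unfolding k by (simp add: monomials_def)
    ultimately show ?thesis
      by blast
  qed
  \<comment> \<open>Both ideals are equal, since \<open>N\<close> contains \<open>M\<close> and consists of multiples of elements of \<open>M\<close>.\<close>
  then have "monomial_ideal X N \<subseteq> (monomial_ideal X M :: (_ \<Rightarrow>\<^sub>0 'k) set)"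
    by (rule monomial_ideal_subsetI[OF \<open>M \<subseteq> monomials X\<close>])
  moreover have "0 \<in> monomials X"
    by (simp add: monomials_def)
  with \<open>M \<subseteq> N\<close> have "monomial_ideal X M \<subseteq> (monomial_ideal X N :: (_ \<Rightarrow>\<^sub>0 'k) set)"
    by (intro monomial_ideal_subsetI[OF N_sub]) force
  ultimately have "initial_ideal X r I = monomial_ideal X M"
    unfolding initial_ideal_def N_def[symmetric] by (rule equalityI)
  then have "squarefree_quadratic_ideal X (initial_ideal X r I)"
    unfolding squarefree_quadratic_ideal_def
    using \<open>M \<subseteq> monomials X\<close> \<open>\<And>u. u \<in> M \<Longrightarrow> squarefree_monomial u \<and> monomial_degree u = 2\<close> by blast
  with r show ?thesis
    unfolding X_def I_def by blast
qed

theorem theorem3p4: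
  fixes G :: "nat pair_pre_digraph" and n :: nat
  assumes "pair_graph G" and "pverts G = {1..n}"
    and "clique_separable G"
  shows "\<exists>r. monomial_order (stable_sets G) r \<and>
    squarefree_quadratic_ideal (stable_sets G)
      (initial_ideal (stable_sets G) r
        (toric_ideal G :: ((nat set \<Rightarrow>\<^sub>0 nat) \<Rightarrow>\<^sub>0 'k::field) set))"
proof -
  obtain \<omega> where "quadratic_weight (stable_sets G) \<omega>"
    using clique_separable_quadratic_weight[OF assms(3)] by blast
  with assms(2) show ?thesis
    by (intro quadratic_weight_initial_ideal) simp_all
qed

end
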